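(* Let $n\ge7$ and let the errors $\epsilon_i$ be i.i.d. $\mathcal{N}(0,\sigma^2)$. Define $$\hat m^{ms}:=\arg\min_{m\in\mathbb{N}}\Big\{\frac1n\sum_{i=1}^nh_{\hat K_m}(U_i)^2-\frac2n\sum_{i=1}^nY_ih_{\hat K_m}(U_i)+\frac{3\mathfrak{c}_{p,1}\sigma^2md\log(3m)}{n}\big(\mathfrak{c}_{p,2}\kappa\log n+1\big)\Big\},$$ with $\mathfrak{c}_{p,1}=16$, $\mathfrak{c}_{p,2}=9\cdot2^{15}$. Let $m_K\in\mathbb{N}\cup\{\infty\}$ and let $K\subset B_2(0,\Gamma)$, $\Gamma<\infty$, with $h_K\in\bar{\mathcal{P}}_{m_K}$. Then $$\mathbb{E}\big[l_d^2(\hat K_{\hat m^{ms}},K)\big]\le\mathfrak{C}_{d,\kappa,\sigma}\min\Big\{\frac{m_K\log(3m_K)\log n}{n},\;n^{-4/(d+3)}(\log n)^{8/(d+3)}\Big\},$$ where $\mathfrak{C}_{d,\kappa,\sigma}$ is a constant depending only on $d,\kappa,\sigma$ (and the first term in the minimum is $+\infty$ when $m_K=\infty$).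
   Context: Let $d\ge2$. For a nonempty compact convex set $K\subset\mathbb{R}^d$ the support function is $h_K(u):=\sup_{x\in K}\langle x,u\rangle$, $u\in\mathbb{S}^{d-1}$ (unit sphere). One observes $(U_i,Y_i)$, $Y_i=h_K(U_i)+\epsilon_i$, $i=1,\dots,n$, where $U_1,\dots,U_n$ are i.i.d. from a probability measure $\nu$ on $\mathbb{S}^{d-1}$, independent of the errors. $B_2(0,\Gamma)$ is the Euclidean ball of radius $\Gamma$ about $0$. $\bar{\mathcal{P}}_m$ is the set of support functions $h_P$ of polytopes $P\subset\mathbb{R}^d$ with at most $m$ vertices, and $\bar{\mathcal{P}}_\infty$ the set of all support functions of nonempty compact convex sets; sets are identified with their support functions. $l_d^2(K,K'):=\frac1n\sum_{i=1}^n(h_K(U_i)-h_{K'}(U_i))^2$. $\hat K_m$ is a minimizer of $\sum_{i=1}^n(Y_i-h_K(U_i))^2$ over $K\in\bar{\mathcal{P}}_m$ (assumed to exist). $\kappa\ge1$ is an absolute constant (it exists, by Mendelson and Vershynin) such that for all $n$, every $V\subset\mathbb{R}^n$ with $\sup_{v\in V}\|v\|_\infty\le B$ and pseudo-dimension at most $t$, and every $\epsilon>0$, the minimal number of Euclidean $\epsilon$-balls covering $V$ is at most $(4+2B\sqrt n/\epsilon)^{\kappa t}$. Here $V\subset\mathbb{R}^n$ has pseudo-dimension at most $t$ if for every set $I\subset\{1,\dots,n\}$ of $t+1$ distinct indices and every $x\in\mathbb{R}^I$ there is $J\subset I$ such that no $v\in V$ satisfies both $v_i>x_i$ for all $i\in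 J$ and $v_i<x_i$ for all $i\in I\setminus J$.
   Formalization: The second term of the minimum carries an extra factor that may depend on Γ as well as d, κ, σ: with a constant free of Γ the claim fails for balls of radius Γ→∞ (the selected fit interpolates the data). The first term keeps a constant depending only on d, κ, σ. *)

theory Defs
  imports "HOL-Probability.Probability"
begin

definition support_function :: "'a::euclidean_space set \<Rightarrow> 'a \<Rightarrow> real" where
  "support_function K u = (SUP x\<in>K. x \<bullet> u)"

(* Support functions are kept as functions on the whole space; being positively homogeneous,
   they are determined by their values on the unit sphere, the only values used below.
   The vertices of a polytope are its extreme points.  Nonemptiness makes the class of
   index 0 empty. *)
definition support_class :: "enat \<Rightarrow> ('a::euclidean_space \<Rightarrow> real) set" where
  "support_class m = (case m of
      enat k \<Rightarrow> {support_function P |P. polytope P \<and> P \<noteq> {} \<and> card {v. v extreme_point_of P} \<le> k}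
    | \<infinity> \<Rightarrow> {support_function K |K. K \<noteq> {} \<and> compact K \<and> convex K})"

definition emp_sq_dist :: "nat \<Rightarrow> (nat \<Rightarrow> 'a::euclidean_space) \<Rightarrow> 'a set \<Rightarrow> 'a set \<Rightarrow> real" where
  "emp_sq_dist n u K L =
     1 / real n * (\<Sum>i=1..n. (support_function K (u i) - support_function L (u i))\<^sup>2)"

definition is_least_squares ::
  "nat \<Rightarrow> (nat \<Rightarrow> 'a::euclidean_space) \<Rightarrow> (nat \<Rightarrow> real) \<Rightarrow> enat \<Rightarrow> 'a set \<Rightarrow> bool" where
  "is_least_squares n u y m K \<longleftrightarrow>
     K \<noteq> {} \<and> compact K \<and> convex K \<and>
     is_arg_min (\<lambda>h. \<Sum>i=1..n. (y i - h (u i))\<^sup>2) (\<lambda>h. h \<in> support_class m) (support_function K)"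

definition selection_criterion ::
  "nat \<Rightarrow> (nat \<Rightarrow> 'a::euclidean_space) \<Rightarrow> (nat \<Rightarrow> real) \<Rightarrow> real \<Rightarrow> real \<Rightarrow> (nat \<Rightarrow> 'a set) \<Rightarrow> nat \<Rightarrow> real" where
  "selection_criterion n u y \<kappa> \<sigma> Khat m =
     1 / real n * (\<Sum>i=1..n. (support_function (Khat m) (u i))\<^sup>2)
     - 2 / real n * (\<Sum>i=1..n. y i * support_function (Khat m) (u i))
     + 3 * 16 * \<sigma>\<^sup>2 * real m * real DIM('a) * ln (3 * real m) / real n
         * (9 * 2 ^ 15 * \<kappa> * ln (real n) + 1)"

(* A vector of R^n is a function nat => real of which only the values at 1, ..., n matter. *)
definition pseudo_dim_le :: "nat \<Rightarrow> (nat \<Rightarrow> real) set \<Rightarrow> nat \<Rightarrow> bool" where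
  "pseudo_dim_le n V t \<longleftrightarrow>
     (\<forall>I x. I \<subseteq> {1..n} \<and> card I = t + 1 \<longrightarrow>
        (\<exists>J\<subseteq>I. \<not> (\<exists>v\<in>V. (\<forall>i\<in>J. v i > x i) \<and> (\<forall>i\<in>I - J. v i < x i))))"

(* Closed balls with arbitrary centres in R^n; the value is infinity if no finite cover exists. *)
definition covering_number :: "nat \<Rightarrow> (nat \<Rightarrow> real) set \<Rightarrow> real \<Rightarrow> enat" where
  "covering_number n V r =
     (INF C\<in>{C. finite C \<and> (\<forall>v\<in>V. \<exists>c\<in>C. L2_set (\<lambda>i. v i - c i) {1..n} \<le> r)}. enat (card C))"

definition covering_constant :: "real \<Rightarrow> bool" where
  "covering_constant \<kappa> \<longleftrightarrow> 1 \<le> \<kappa> \<and>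
     (\<forall>n V B t r. 0 \<le> B \<and> (\<forall>v\<in>V. \<forall>i\<in>{1..n}. \<bar>v i\<bar> \<le> B) \<and> pseudo_dim_le n V t \<and> 0 < r \<longrightarrow>
        ereal_of_enat (covering_number n V r)
          \<le> ereal ((4 + 2 * B * sqrt (real n) / r) powr (\<kappa> * real t)))"

(* The design law \<nu> is a measure on the sphere itself, so the design points lie on it surely.
   The last conjunct is the independence of design and errors, through the sigma-algebras they
   generate, because prob_space.indep_var requires both variables to have the same type. *)
definition gaussian_design ::
  "'w measure \<Rightarrow> nat \<Rightarrow> 'a::euclidean_space measure \<Rightarrow> real
     \<Rightarrow> (nat \<Rightarrow> 'w \<Rightarrow> 'a) \<Rightarrow> (nat \<Rightarrow> 'w \<Rightarrow> real) \<Rightarrow> bool" where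
  "gaussian_design M n \<nu> \<sigma> U \<epsilon> \<longleftrightarrow>
     prob_space M \<and>
     prob_space \<nu> \<and> sets \<nu> = sets (restrict_space borel (sphere 0 1)) \<and>
     prob_space.indep_vars M (\<lambda>_. \<nu>) U {1..n} \<and>
     (\<forall>i\<in>{1..n}. distr M \<nu> (U i) = \<nu>) \<and>
     prob_space.indep_vars M (\<lambda>_. borel) \<epsilon> {1..n} \<and>
     (\<forall>i\<in>{1..n}. distributed M lborel (\<epsilon> i) (\<lambda>x. ennreal (normal_density 0 \<sigma> x))) \<and>
     prob_space.indep_set M
       (sets (vimage_algebra (space M) (\<lambda>\<omega>. \<lambda>i\<in>{1..n}. U i \<omega>) (\<Pi>\<^sub>M i\<in>{1..n}. \<nu>)))
       (sets (vimage_algebra (space M) (\<lambda>\<omega>. \<lambda>i\<in>{1..n}. \<epsilon> i \<omega>) (\<Pi>\<^sub>M i\<in>{1..n}. borel)))"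

definition vertex_rate :: "nat \<Rightarrow> enat \<Rightarrow> ennreal" where
  "vertex_rate n m = (case m of
      enat k \<Rightarrow> ennreal (real k * ln (3 * real k) * ln (real n) / real n)
    | \<infinity> \<Rightarrow> \<infinity>)"

(* The rate for general bodies contained in a ball of radius R needs a constant depending on R:
   if K is a ball whose radius grows while n stays fixed, the selected least squares estimator
   ends up interpolating the data and its risk stays of order \<sigma>^2. *)
definition body_rate :: "nat \<Rightarrow> nat \<Rightarrow> ennreal" where
  "body_rate d n =
     ennreal (real n powr (- 4 / (real d + 3)) * ln (real n) powr (8 / (real d + 3)))"

end

theory Submission
  imports Defs
begin

text \<open>A polytope with \<open>m\<close> vertices \<open>v\<^sub>j\<close> has the support function \<open>u \<mapsto> max\<^sub>j \<langle>v\<^sub>j, u\<rangle>\<close>. For fixed design points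
  the choice of the maximising \<open>j\<close> at each \<open>u\<^sub>i\<close> is read off the signs of \<open>n m\<^sup>2\<close> linear functionals of
  \<open>(v\<^sub>j)\<^sub>j\<close>, so at most \<open>(n m\<^sup>2 + 1)\<^bsup>m d\<^esup>\<close> choices occur, and for each of them the vectors
  \<open>(h\<^sub>P (u\<^sub>i))\<^sub>i\<close> lie in one linear subspace of dimension \<open>m d\<close>. Hence the class of index \<open>m\<close> is covered
  by few subspaces, chi-square tails give a noise level of order \<open>\<sigma>\<^sup>2 m d log (n m)\<close>, and the penalty dominates
  it simultaneously for all \<open>m\<close>. The minimising property of the selected estimator then gives an inequality
  comparing its risk with that of every polytope; the two rates come from \<open>K\<close> itself and from approximating
  \<open>K\<close> by a polytope with \<open>O(N\<^bsup>d - 1\<^esup>)\<close> vertices within \<open>O(N\<^bsup>-2\<^esup>)\<close>.\<close>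

subsection \<open>Gaussian vectors projected to a subspace\<close>

text \<open>The estimators have no a priori bound: the vertices of a least squares polytope may lie
  anywhere. The argument is therefore scale free. A quarter of the squared distance to the
  comparison polytope is held back from the loss and subtracted from the noise term. The supremum of
  the resulting quadratic over a whole linear subspace is then finite, namely four times the squared
  norm of the projected noise. Dividing by \<open>16 * \<sigma>\<^sup>2\<close> leads to an
  exponential moment that equals \<open>sqrt 2\<close> to the power of the dimension. The radius of
  \<open>K\<close> enters only through the approximation error. A second obstacle is that neither
  the estimators nor the selected index are assumed measurable. The loss is thus bounded outcome by
  outcome, by a supremum over all vertex configurations, summed over all \<open>m\<close>. The
  integral of the loss is used only through monotonicity; measurability is established for the
  majorant, which is integrated first over the errors with the design held fixed.\<close>

definition gauss :: "real \<Rightarrow> real measure" where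
  "gauss \<sigma> = density lborel (\<lambda>x. ennreal (normal_density 0 \<sigma> x))"

lemma sets_gauss [simp, measurable_cong]: "sets (gauss \<sigma>) = sets borel"
  by (simp add: gauss_def)

lemma space_gauss [simp]: "space (gauss \<sigma>) = UNIV"
  by (simp add: gauss_def)

lemma prob_space_gauss: "0 < \<sigma> \<Longrightarrow> prob_space (gauss \<sigma>)"
  unfolding gauss_def by (rule prob_space_normal_density)

lemma nn_integral_normal_density:
  assumes "0 < \<sigma>"
  shows "(\<integral>\<^sup>+x. ennreal (normal_density \<mu> \<sigma> x) \<partial>lborel) = 1"
proof -
  interpret prob_space "density lborel (\<lambda>x. ennreal (normal_density \<mu> \<sigma> x))"
    by (rule prob_space_normal_density[OF assms])
  show ?thesis
    using emeasure_space_1 by (simp add: emeasure_density)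
qed

lemma nn_integral_gauss_exp:
  assumes "0 < \<sigma>"
  shows "(\<integral>\<^sup>+x. ennreal (exp (t * x)) \<partial>gauss \<sigma>) = ennreal (exp (\<sigma>\<^sup>2 * t\<^sup>2 / 2))"
proof -
  have *: "normal_density 0 \<sigma> x * exp (t * x) = exp (\<sigma>\<^sup>2 * t\<^sup>2 / 2) * normal_density (\<sigma>\<^sup>2 * t) \<sigma> x" for x
  proof -
    have "- (x - 0)\<^sup>2 / (2 * \<sigma>\<^sup>2) + t * x = \<sigma>\<^sup>2 * t\<^sup>2 / 2 + - (x - \<sigma>\<^sup>2 * t)\<^sup>2 / (2 * \<sigma>\<^sup>2)"
      using assms by (simp add: field_simps power2_eq_square)
    then show ?thesis
      unfolding normal_density_def by (simp add: exp_add[symmetric] mult.commute mult.left_commute)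
  qed
  have "(\<integral>\<^sup>+x. ennreal (exp (t * x)) \<partial>gauss \<sigma>)
      = (\<integral>\<^sup>+x. ennreal (exp (\<sigma>\<^sup>2 * t\<^sup>2 / 2)) * ennreal (normal_density (\<sigma>\<^sup>2 * t) \<sigma> x) \<partial>lborel)"
    unfolding gauss_def
    by (subst nn_integral_density) (auto simp: ennreal_mult'[symmetric] *)
  then show ?thesis
    using nn_integral_normal_density[OF assms] by (simp add: nn_integral_cmult)
qed

text \<open>The factor \<open>exp (x\<^sup>2 / 4)\<close> turns the exponent of variance 1 into that
  of variance 2; \<open>sqrt 2\<close> is the quotient of the normalising constants.\<close>

lemma nn_integral_gauss_exp_square:
  "(\<integral>\<^sup>+x. ennreal (exp (x\<^sup>2 / 4)) \<partial>gauss 1) = ennreal (sqrt 2)"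
proof -
  have *: "normal_density 0 1 x * exp (x\<^sup>2 / 4) = sqrt 2 * normal_density 0 (sqrt 2) x" for x
  proof -
    have "- (x - 0)\<^sup>2 / (2 * 1\<^sup>2) + x\<^sup>2 / 4 = - (x - 0)\<^sup>2 / (2 * (sqrt 2)\<^sup>2)"
      by (simp add: field_simps)
    then have "exp (- (x - 0)\<^sup>2 / (2 * 1\<^sup>2)) * exp (x\<^sup>2 / 4) = exp (- (x - 0)\<^sup>2 / (2 * (sqrt 2)\<^sup>2))"
      by (metis exp_add)
    then show ?thesis
      unfolding normal_density_def by (simp add: real_sqrt_mult real_divide_square_eq field_simps)
  qed
  have "(\<integral>\<^sup>+x. ennreal (exp (x\<^sup>2 / 4)) \<partial>gauss 1)
      = (\<integral>\<^sup>+x. ennreal (sqrt 2) * ennreal (normal_density 0 (sqrt 2) x) \<partial>lborel)"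
    unfolding gauss_def
    by (subst nn_integral_density) (auto simp: ennreal_mult'[symmetric] *)
  then show ?thesis
    by (simp add: nn_integral_cmult nn_integral_normal_density)
qed

text \<open>Vectors are families over an index set and not points of a Euclidean type, because the
  sample size is a variable and cannot be a type.\<close>

definition orthonormal_on :: "'t set \<Rightarrow> 'j set \<Rightarrow> ('j \<Rightarrow> 't \<Rightarrow> real) \<Rightarrow> bool" where
  "orthonormal_on T J q \<longleftrightarrow>
     (\<forall>j\<in>J. \<forall>k\<in>J. (\<Sum>i\<in>T. q j i * q k i) = (if j = k then 1 else 0))"

lemma orthonormal_on_sum_square:
  assumes "orthonormal_on T J q" "finite J"
  shows "(\<Sum>i\<in>T. (\<Sum>j\<in>J. c j * q j i)\<^sup>2) = (\<Sum>j\<in>J. (c j)\<^sup>2)"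
proof -
  have "(\<Sum>i\<in>T. (\<Sum>j\<in>J. c j * q j i)\<^sup>2) = (\<Sum>i\<in>T. \<Sum>j\<in>J. \<Sum>k\<in>J. c j * c k * (q j i * q k i))"
    by (simp add: power2_eq_square sum_product ac_simps)
  also have "\<dots> = (\<Sum>j\<in>J. \<Sum>k\<in>J. c j * c k * (\<Sum>i\<in>T. q j i * q k i))"
    by (simp only: sum.swap[of _ J T] sum_distrib_left)
  also have "\<dots> = (\<Sum>j\<in>J. \<Sum>k\<in>J. c j * c k * (if j = k then 1 else 0))"
    using assms unfolding orthonormal_on_def by (intro sum.cong) auto
  also have "\<dots> = (\<Sum>j\<in>J. (c j)\<^sup>2)"
    using assms by (intro sum.cong) (auto simp: power2_eq_square if_distrib cong: if_cong)
  finally show ?thesis .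
qed

text \<open>The square in the exponent is linearised by \<open>exp (y\<^sup>2 / 4) = E exp (y g / sqrt 2)\<close>
  with a standard Gaussian \<open>g\<close>; after exchanging the integrals, orthonormality decouples the \<open>g\<^sub>j\<close>.\<close>

lemma nn_integral_exp_projection:
  fixes q :: "'j \<Rightarrow> 't \<Rightarrow> real"
  assumes "0 < \<sigma>" "finite T" "finite J" "orthonormal_on T J q"
  shows "(\<integral>\<^sup>+e. ennreal (exp ((\<Sum>j\<in>J. (\<Sum>i\<in>T. e i * q j i)\<^sup>2) / (4 * \<sigma>\<^sup>2))) \<partial>(\<Pi>\<^sub>M i\<in>T. gauss \<sigma>))
    = ennreal (sqrt 2 ^ card J)"
proof -
  interpret G: prob_space "gauss \<sigma>" by (rule prob_space_gauss[OF assms(1)])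
  interpret G1: prob_space "gauss 1" by (rule prob_space_gauss) simp
  interpret E: product_prob_space "\<lambda>_. gauss \<sigma>" T ..
  interpret S: product_prob_space "\<lambda>_. gauss 1" J ..
  interpret E': finite_product_prob_space "\<lambda>_. gauss \<sigma>" T by standard (rule assms)
  interpret S': finite_product_prob_space "\<lambda>_. gauss 1" J by standard (rule assms)
  interpret P: pair_sigma_finite "\<Pi>\<^sub>M j\<in>J. gauss 1" "\<Pi>\<^sub>M i\<in>T. gauss \<sigma>" ..
  \<comment> \<open>This scaling serves both integrals: integrating out \<open>g\<close> gives
    \<open>exp ((y j)\<^sup>2 / (4 * \<sigma>\<^sup>2))\<close>, integrating out \<open>e\<close>
    gives \<open>exp ((w i)\<^sup>2 / 4)\<close>.\<close>
  define s where "s = 1 / (\<sigma> * sqrt 2)"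
  have s2: "s\<^sup>2 = 1 / (2 * \<sigma>\<^sup>2)"
    using assms(1) by (simp add: s_def power_divide power_mult_distrib)
  have "(\<integral>\<^sup>+e. ennreal (exp ((\<Sum>j\<in>J. (\<Sum>i\<in>T. e i * q j i)\<^sup>2) / (4 * \<sigma>\<^sup>2))) \<partial>(\<Pi>\<^sub>M i\<in>T. gauss \<sigma>))
     = (\<integral>\<^sup>+e. (\<integral>\<^sup>+g. ennreal (exp (s * (\<Sum>j\<in>J. \<Sum>i\<in>T. g j * e i * q j i))) \<partial>(\<Pi>\<^sub>M j\<in>J. gauss 1)) \<partial>(\<Pi>\<^sub>M i\<in>T. gauss \<sigma>))"
  proof (rule nn_integral_cong)
    fix e :: "'t \<Rightarrow> real"
    define y where "y j = (\<Sum>i\<in>T. e i * q j i)" for j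
    have "(\<integral>\<^sup>+g. ennreal (exp (s * (\<Sum>j\<in>J. \<Sum>i\<in>T. g j * e i * q j i))) \<partial>(\<Pi>\<^sub>M j\<in>J. gauss 1))
      = (\<integral>\<^sup>+g. (\<Prod>j\<in>J. ennreal (exp ((s * y j) * g j))) \<partial>(\<Pi>\<^sub>M j\<in>J. gauss 1))"
      by (intro nn_integral_cong)
         (simp add: prod_ennreal exp_sum[OF assms(3), symmetric] y_def sum_distrib_left sum_distrib_right ac_simps)
    also have "\<dots> = (\<Prod>j\<in>J. (\<integral>\<^sup>+x. ennreal (exp ((s * y j) * x)) \<partial>gauss 1))"
      by (intro S.product_nn_integral_prod assms) measurable
    also have "\<dots> = (\<Prod>j\<in>J. ennreal (exp ((y j)\<^sup>2 / (4 * \<sigma>\<^sup>2))))"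
      by (intro prod.cong refl, subst nn_integral_gauss_exp) (auto simp: power_mult_distrib s2)
    also have "\<dots> = ennreal (exp ((\<Sum>j\<in>J. (y j)\<^sup>2) / (4 * \<sigma>\<^sup>2)))"
      by (simp add: prod_ennreal exp_sum[OF assms(3), symmetric] sum_divide_distrib)
    finally show "ennreal (exp ((\<Sum>j\<in>J. (\<Sum>i\<in>T. e i * q j i)\<^sup>2) / (4 * \<sigma>\<^sup>2))) =
      (\<integral>\<^sup>+g. ennreal (exp (s * (\<Sum>j\<in>J. \<Sum>i\<in>T. g j * e i * q j i))) \<partial>(\<Pi>\<^sub>M j\<in>J. gauss 1))"
      by (simp add: y_def)
  qed
  also have "\<dots> = (\<integral>\<^sup>+g. (\<integral>\<^sup>+e. ennreal (exp (s * (\<Sum>j\<in>J. \<Sum>i\<in>T. g j * e i * q j i))) \<partial>(\<Pi>\<^sub>M i\<in>T. gauss \<sigma>)) \<partial>(\<Pi>\<^sub>M j\<in>J. gauss 1))"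
    by (rule P.Fubini') measurable
  also have "\<dots> = (\<integral>\<^sup>+g. (\<Prod>j\<in>J. ennreal (exp ((g j)\<^sup>2 / 4))) \<partial>(\<Pi>\<^sub>M j\<in>J. gauss 1))"
  proof (rule nn_integral_cong)
    fix g :: "'j \<Rightarrow> real"
    define w where "w i = (\<Sum>j\<in>J. g j * q j i)" for i
    have "(\<integral>\<^sup>+e. ennreal (exp (s * (\<Sum>j\<in>J. \<Sum>i\<in>T. g j * e i * q j i))) \<partial>(\<Pi>\<^sub>M i\<in>T. gauss \<sigma>))
      = (\<integral>\<^sup>+e. (\<Prod>i\<in>T. ennreal (exp ((s * w i) * e i))) \<partial>(\<Pi>\<^sub>M i\<in>T. gauss \<sigma>))"
      by (subst sum.swap, intro nn_integral_cong)
         (simp add: prod_ennreal exp_sum[OF assms(2), symmetric] w_def sum_distrib_left sum_distrib_right ac_simps)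
    also have "\<dots> = (\<Prod>i\<in>T. (\<integral>\<^sup>+x. ennreal (exp ((s * w i) * x)) \<partial>gauss \<sigma>))"
      by (intro E.product_nn_integral_prod assms) measurable
    also have "\<dots> = (\<Prod>i\<in>T. ennreal (exp ((w i)\<^sup>2 / 4)))"
      using assms(1) by (intro prod.cong refl, subst nn_integral_gauss_exp) (auto simp: power_mult_distrib s2)
    also have "\<dots> = ennreal (exp ((\<Sum>i\<in>T. (w i)\<^sup>2) / 4))"
      by (simp add: prod_ennreal exp_sum[OF assms(2), symmetric] sum_divide_distrib)
    also have "(\<Sum>i\<in>T. (w i)\<^sup>2) = (\<Sum>j\<in>J. (g j)\<^sup>2)"
      unfolding w_def by (rule orthonormal_on_sum_square[OF assms(4,3)])
    also have "ennreal (exp ((\<Sum>j\<in>J. (g j)\<^sup>2) / 4)) = (\<Prod>j\<in>J. ennreal (exp ((g j)\<^sup>2 / 4)))"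
      by (simp add: prod_ennreal exp_sum[OF assms(3), symmetric] sum_divide_distrib)
    finally show "(\<integral>\<^sup>+e. ennreal (exp (s * (\<Sum>j\<in>J. \<Sum>i\<in>T. g j * e i * q j i))) \<partial>(\<Pi>\<^sub>M i\<in>T. gauss \<sigma>)) =
      (\<Prod>j\<in>J. ennreal (exp ((g j)\<^sup>2 / 4)))" .
  qed
  also have "\<dots> = (\<Prod>j\<in>J. (\<integral>\<^sup>+x. ennreal (exp (x\<^sup>2 / 4)) \<partial>gauss 1))"
    by (intro S.product_nn_integral_prod assms) measurable
  also have "\<dots> = ennreal (sqrt 2 ^ card J)"
    by (simp add: nn_integral_gauss_exp_square ennreal_power)
  finally show ?thesis .
qed

text \<open>Gram-Schmidt. The orthonormal vectors are indexed by those elements of \<open>I\<close>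
  that enlarge the span, so \<open>J \<subseteq> I\<close> bounds their number without any notion of
  dimension.\<close>

lemma ex_orthonormal_on:
  fixes w :: "'i \<Rightarrow> 't \<Rightarrow> real"
  assumes "finite I" "finite T"
  shows "\<exists>J q c. J \<subseteq> I \<and> orthonormal_on T J q \<and> (\<forall>k\<in>I. \<forall>t\<in>T. w k t = (\<Sum>j\<in>J. c k j * q j t))"
  using assms(1)
proof (induction I)
  case empty
  show ?case by (intro exI[of _ "{}"]) (auto simp: orthonormal_on_def)
next
  case (insert k I)
  then obtain J q c where J: "J \<subseteq> I" and on: "orthonormal_on T J q"
    and w: "\<forall>k\<in>I. \<forall>t\<in>T. w k t = (\<Sum>j\<in>J. c k j * q j t)" by blast
  have finJ: "finite J" using J insert by (auto intro: finite_subset)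
  have kJ: "k \<notin> J" using J insert by auto
  define p where "p j = (\<Sum>t\<in>T. w k t * q j t)" for j
  define r where "r t = w k t - (\<Sum>j\<in>J. p j * q j t)" for t
  define \<rho> where "\<rho> = sqrt (\<Sum>t\<in>T. (r t)\<^sup>2)"
  have orth: "(\<Sum>t\<in>T. r t * q j t) = 0" if j: "j \<in> J" for j
  proof -
    have "(\<Sum>t\<in>T. r t * q j t) = p j - (\<Sum>t\<in>T. \<Sum>l\<in>J. p l * (q l t * q j t))"
      unfolding r_def left_diff_distrib sum_subtractf sum_distrib_right p_def[of j] mult.assoc ..
    also have "(\<Sum>t\<in>T. \<Sum>l\<in>J. p l * (q l t * q j t)) = (\<Sum>l\<in>J. p l * (\<Sum>t\<in>T. q l t * q j t))"
      by (subst sum.swap) (simp add: sum_distrib_left)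
    also have "\<dots> = (\<Sum>l\<in>J. p l * (if l = j then 1 else 0))"
      using on j unfolding orthonormal_on_def by (intro sum.cong) auto
    also have "\<dots> = p j" using finJ j by (simp add: if_distrib cong: if_cong)
    finally show ?thesis by simp
  qed
  show ?case
  proof (cases "\<rho> = 0")
    case True
    then have "\<forall>t\<in>T. r t = 0"
      using assms(2) by (simp add: \<rho>_def sum_nonneg_eq_0_iff)
    then have "\<forall>t\<in>T. w k t = (\<Sum>j\<in>J. p j * q j t)" by (simp add: r_def)
    then show ?thesis
      using J on w insert.hyps
      by (intro exI[of _ J] exI[of _ q] exI[of _ "c(k := p)"]) auto
  next
    case False
    have \<rho>2: "(\<Sum>t\<in>T. (r t)\<^sup>2) = \<rho>\<^sup>2" by (simp add: \<rho>_def sum_nonneg)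
    define q' where "q' = q(k := (\<lambda>t. r t / \<rho>))"
    have q'J: "q' j = q j" if "j \<in> J" for j using that kJ by (auto simp: q'_def)
    have q'k: "q' k = (\<lambda>t. r t / \<rho>)" by (simp add: q'_def)
    have on': "orthonormal_on T (insert k J) q'"
      unfolding orthonormal_on_def
    proof (intro ballI)
      fix a b assume ab: "a \<in> insert k J" "b \<in> insert k J"
      have kk: "(\<Sum>i\<in>T. q' k i * q' k i) = 1"
        using False \<rho>2 by (simp add: q'k sum_divide_distrib[symmetric] power2_eq_square)
      have kj: "(\<Sum>i\<in>T. q' k i * q' j i) = 0" "(\<Sum>i\<in>T. q' j i * q' k i) = 0" if "j \<in> J" for j
        using orth[OF that] by (auto simp: q'k q'J[OF that] sum_divide_distrib[symmetric] mult.commute)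
      show "(\<Sum>i\<in>T. q' a i * q' b i) = (if a = b then 1 else 0)"
        using ab on kk kj kJ unfolding orthonormal_on_def by (auto simp: q'J)
    qed
    \<comment> \<open>The old coefficients \<open>c l\<close> are arbitrary outside
      \<open>J\<close>, so they are set to 0 at the new index; \<open>w k\<close> itself is its
      projection plus \<open>\<rho>\<close> times the new unit vector.\<close>
    define c' where "c' = (\<lambda>l. if l = k then p(k := \<rho>) else (c l)(k := 0))"
    have "w l t = (\<Sum>j\<in>insert k J. c' l j * q' j t)" if l: "l \<in> insert k I" and t: "t \<in> T" for l t
    proof (cases "l = k")
      case True
      have "(\<Sum>j\<in>insert k J. c' k j * q' j t) = \<rho> * (r t / \<rho>) + (\<Sum>j\<in>J. p j * q j t)"
        using kJ finJ by (simp add: c'_def q'k) (intro sum.cong, auto simp: q'J)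
      then show ?thesis using True False by (simp add: r_def)
    next
      case F: False
      have "(\<Sum>j\<in>insert k J. c' l j * q' j t) = (\<Sum>j\<in>J. c l j * q j t)"
        using kJ finJ F by (simp add: c'_def) (intro sum.cong, auto simp: q'J)
      then show ?thesis using F l t w by auto
    qed
    then show ?thesis
      using on' J by (intro exI[of _ "insert k J"] exI[of _ q'] exI[of _ c']) auto
  qed
qed

subsection \<open>Counting sign patterns\<close>

text \<open>A cell of a central hyperplane arrangement, recorded by the functionals that are
  nonnegative on it. Points on a hyperplane are assigned to its nonnegative side, so ties need no
  separate treatment.\<close>

definition sign_patterns :: "'q set \<Rightarrow> 'i set \<Rightarrow> ('q \<Rightarrow> 'i \<Rightarrow> real) \<Rightarrow> 'q set set" where
  "sign_patterns Q I g = range (\<lambda>c. {x \<in> Q. 0 \<le> (\<Sum>l\<in>I. g x l * c l)})"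

lemma finite_sign_patterns: "finite Q \<Longrightarrow> finite (sign_patterns Q I g)"
  by (rule finite_subset[of _ "Pow Q"]) (auto simp: sign_patterns_def)

text \<open>Adding a hyperplane \<open>H\<close> splits only the cells that meet \<open>H\<close>: a cell with points on both sides meets \<open>H\<close> by convexity.\<close>

lemma card_sign_patterns_le:
  fixes g :: "'q \<Rightarrow> 'i \<Rightarrow> real"
  assumes "finite Q" "finite I"
  shows "card (sign_patterns Q I g) \<le> (card Q + 1) ^ card I"
  using assms
proof (induction Q arbitrary: I g)
  case empty
  have "sign_patterns {} I g = {{}}" by (auto simp: sign_patterns_def)
  then show ?case by simp
next
  case (insert f Q)
  define S where "S = sign_patterns Q I g"
  define B where "B = {A. A \<subseteq> Q \<and> A \<in> sign_patterns (insert f Q) I g \<and> insert f A \<in> sign_patterns (insert f Q) I g}"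
  have finS: "finite S" using insert by (simp add: S_def finite_sign_patterns)
  have finB: "finite B" using insert by (auto simp: B_def)
  have sub: "A - {f} \<in> S" if A: "A \<in> sign_patterns (insert f Q) I g" for A
    using A insert.hyps unfolding S_def sign_patterns_def by auto
  have "card (sign_patterns (insert f Q) I g) \<le> card S + card B"
  proof -
    define P where "P = sign_patterns (insert f Q) I g"
    \<comment> \<open>The patterns containing \<open>f\<close> whose twin without \<open>f\<close>
      also occurs. Deleting \<open>f\<close> is injective on the others, which are therefore at most
      as many as the patterns of \<open>Q\<close>.\<close>
    define P1 where "P1 = {A\<in>P. f \<in> A \<and> A - {f} \<in> P}"
    have finP: "finite P" using insert by (simp add: P_def finite_sign_patterns)
    have "inj_on (\<lambda>A. A - {f}) (P - P1)"
    proof (rule inj_onI)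
      fix A A' assume h: "A \<in> P - P1" "A' \<in> P - P1" "A - {f} = A' - {f}"
      have no: "X - {f} \<notin> P" if "X \<in> P - P1" "f \<in> X" for X
        using that by (simp add: P1_def)
      have "f \<in> A \<longleftrightarrow> f \<in> A'"
        using no[of A] no[of A'] h by (metis DiffD1 Diff_empty Diff_insert0)
      then show "A = A'"
        using h(3) by (metis Diff_empty Diff_insert0 insert_Diff)
    qed
    then have "card (P - P1) \<le> card S"
      using sub finS by (intro card_inj_on_le[of "\<lambda>A. A - {f}"]) (auto simp: P_def)
    moreover have "card P1 \<le> card B"
    proof (rule card_inj_on_le[of "\<lambda>A. A - {f}"])
      show "inj_on (\<lambda>A. A - {f}) P1" by (rule inj_onI) (auto simp: P1_def)
      show "(\<lambda>A. A - {f}) ` P1 \<subseteq> B"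
      proof
        fix A' assume "A' \<in> (\<lambda>A. A - {f}) ` P1"
        then obtain A where A: "A \<in> P" "f \<in> A" "A - {f} \<in> P" "A' = A - {f}"
          by (auto simp: P1_def)
        have "A \<subseteq> insert f Q"
          using A(1) by (auto simp: P_def sign_patterns_def)
        then show "A' \<in> B"
          using A insert_Diff[OF A(2)] unfolding B_def P_def by auto
      qed
    qed (rule finB)
    moreover have "card P = card (P - P1) + card P1"
    proof -
      have "P1 \<subseteq> P" by (auto simp: P1_def)
      then show ?thesis
        using finP by (metis card_Diff_subset card_mono finite_subset le_add_diff_inverse2)
    qed
    ultimately show ?thesis by (simp add: P_def)
  qed
  have cS: "card S \<le> (card Q + 1) ^ card I"
    unfolding S_def using insert by simp
  show ?case
  proof (cases "\<exists>k\<in>I. g f k \<noteq> 0")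
    case False
    then have "f \<in> A" if "A \<in> sign_patterns (insert f Q) I g" for A
      using that by (auto simp: sign_patterns_def)
    then have "B = {}" using insert.hyps by (auto simp: B_def)
    then show ?thesis
      using \<open>card (sign_patterns (insert f Q) I g) \<le> card S + card B\<close> cS insert.hyps
        power_mono[of "card Q + 1" "card (insert f Q) + 1" "card I"] by simp
  next
    case True
    then obtain k where k: "k \<in> I" "g f k \<noteq> 0" by blast
    \<comment> \<open>The functionals restricted to the hyperplane of \<open>f\<close>, where
      coordinate \<open>k\<close> is eliminated by solving \<open>f\<close> for it. This costs one
      dimension in the induction.\<close>
    define g' where "g' x l = g x l - g x k * g f l / g f k" for x l
    define I' where "I' = I - {k}"
    have finI': "finite I'" using insert by (simp add: I'_def)
    have "B \<subseteq> sign_patterns Q I' g'"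
    proof
      fix A assume A: "A \<in> B"
      then have AQ: "A \<subseteq> Q" and fA: "f \<notin> A" using insert.hyps by (auto simp: B_def)
      define L where "L x c = (\<Sum>l\<in>I. g x l * c l)" for x c
      from A obtain a b where a: "A = {x \<in> insert f Q. 0 \<le> L x a}"
        and b: "insert f A = {x \<in> insert f Q. 0 \<le> L x b}"
        by (auto simp: B_def sign_patterns_def L_def)
      have a': "x \<in> A \<longleftrightarrow> x \<in> insert f Q \<and> 0 \<le> L x a" for x
        by (subst a) simp
      have b': "x \<in> insert f A \<longleftrightarrow> x \<in> insert f Q \<and> 0 \<le> L x b" for x
        by (subst b) simp
      have fa: "L f a < 0" using a'[of f] fA by simp
      have fb: "0 \<le> L f b" using b'[of f] by simp
      define t where "t = L f b / (L f b - L f a)"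
      \<comment> \<open>\<open>t\<close> is where the segment from \<open>b\<close> to
        \<open>a\<close> crosses the hyperplane of \<open>f\<close>. It may be 0, but
        \<open>t < 1\<close> is strict, which keeps \<open>(1 - t) * L x b\<close> negative for
        \<open>x\<close> outside \<open>A\<close>.\<close>
      have t: "0 \<le> t" "t < 1" using fa fb by (auto simp: t_def field_simps)
      define c where "c l = t * a l + (1 - t) * b l" for l
      have Lc: "L x c = t * L x a + (1 - t) * L x b" for x
        by (simp add: L_def c_def sum_distrib_left sum.distrib[symmetric] algebra_simps)
      have fc: "L f c = 0"
      proof -
        have "L f b - L f a \<noteq> 0" using fa fb by linarith
        then have "1 - t = - L f a / (L f b - L f a)"
          by (simp add: t_def diff_divide_eq_iff)
        then show ?thesis by (simp add: Lc) (simp add: t_def)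
      qed
      have sgn: "0 \<le> L x c \<longleftrightarrow> x \<in> A" if x: "x \<in> Q" for x
      proof (cases "x \<in> A")
        case True
        then have "0 \<le> L x a" "0 \<le> L x b" using a'[of x] b'[of x] by auto
        then show ?thesis using True t by (simp add: Lc)
      next
        case False
        moreover have "x \<noteq> f" using x insert.hyps by auto
        ultimately have "L x a < 0" "L x b < 0" using a'[of x] b'[of x] x by auto
        then have "t * L x a \<le> 0" "(1 - t) * L x b < 0"
          using t by (auto simp: mult_nonneg_nonpos mult_pos_neg)
        then show ?thesis using False by (simp add: Lc)
      qed
      have split: "L x d = g x k * d k + (\<Sum>l\<in>I'. g x l * d l)" for x d
        unfolding L_def I'_def using insert.prems k by (subst sum.remove[of I k]) auto
      have ck: "c k = - (\<Sum>l\<in>I'. g f l * c l) / g f k"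
        using fc k(2) split[of f c] by (simp add: field_simps)
      have "(\<Sum>l\<in>I'. g' x l * c l) = L x c" for x
      proof -
        have "(\<Sum>l\<in>I'. g' x l * c l) = (\<Sum>l\<in>I'. g x l * c l) - (\<Sum>l\<in>I'. g x k / g f k * (g f l * c l))"
          by (simp add: g'_def left_diff_distrib sum_subtractf mult.assoc)
        also have "\<dots> = (\<Sum>l\<in>I'. g x l * c l) + g x k * c k"
          by (subst sum_distrib_left[symmetric]) (simp add: ck)
        finally show ?thesis by (simp add: split)
      qed
      then have "A = {x \<in> Q. 0 \<le> (\<Sum>l\<in>I'. g' x l * c l)}"
        using sgn AQ by (simp add: set_eq_iff) blast
      then show "A \<in> sign_patterns Q I' g'"
        unfolding sign_patterns_def by (rule range_eqI[where x = c])
    qed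
    then have "card B \<le> card (sign_patterns Q I' g')"
      by (intro card_mono finite_sign_patterns insert.hyps)
    also have "\<dots> \<le> (card Q + 1) ^ card I'"
      using insert.IH finI' by blast
    finally have cB: "card B \<le> (card Q + 1) ^ card I'" .
    have cI: "card I = Suc (card I')"
      using k insert.prems card_Suc_Diff1[of I k] by (simp add: I'_def)
    have "card S + card B \<le> (card Q + 1) ^ Suc (card I') + (card Q + 1) ^ card I'"
      using cS cB cI by simp
    also have "\<dots> = (card Q + 1) ^ card I' * (card Q + 2)" by simp
    also have "\<dots> \<le> (card Q + 2) ^ card I' * (card Q + 2)"
      by (intro mult_right_mono power_mono) auto
    also have "\<dots> = (card (insert f Q) + 1) ^ card I"
      using insert.hyps by (simp add: cI)
    finally show ?thesis
      using \<open>card (sign_patterns (insert f Q) I g) \<le> card S + card B\<close> by linarith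
  qed
qed

subsection \<open>Maxima of linear functionals and the noise\<close>

lemma sum_Basis_inner: "(\<Sum>b\<in>Basis. (b \<bullet> x) * (b \<bullet> y)) = x \<bullet> (y::'a::euclidean_space)"
  by (simp add: euclidean_inner[of x y] inner_commute)

text \<open>Only \<open>v 0\<close>, ..., \<open>v (m - 1)\<close> matter, and repetitions are
  allowed; polytopes with fewer vertices are thus included, and the class is parametrised by
  \<open>m\<close> times the dimension many reals.\<close>

definition vertex_max :: "nat \<Rightarrow> (nat \<Rightarrow> 'a::euclidean_space) \<Rightarrow> 'a \<Rightarrow> real" where
  "vertex_max m v u = Max ((\<lambda>j. v j \<bullet> u) ` {..<m})"

lemma vertex_max_eqI:
  assumes "j < m" "\<And>k. k < m \<Longrightarrow> v k \<bullet> u \<le> v j \<bullet> u"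
  shows "vertex_max m v u = v j \<bullet> u"
  unfolding vertex_max_def using assms by (intro Max_eqI) auto

lemma vertex_max_attained:
  assumes "1 \<le> m"
  obtains j where "j < m" "vertex_max m v u = v j \<bullet> u" "\<And>k. k < m \<Longrightarrow> v k \<bullet> u \<le> v j \<bullet> u"
proof -
  have "vertex_max m v u \<in> (\<lambda>j. v j \<bullet> u) ` {..<m}"
    unfolding vertex_max_def using assms by (intro Max_in) (auto simp: lessThan_empty_iff)
  then obtain j where j: "j < m" "vertex_max m v u = v j \<bullet> u" by auto
  moreover have "v k \<bullet> u \<le> vertex_max m v u" if "k < m" for k
    unfolding vertex_max_def using that by (intro Max_ge) auto
  ultimately show ?thesis using that by simp
qed

lemma vertex_max_le:
  assumes "1 \<le> m" "\<And>j. j < m \<Longrightarrow> norm (v j - w j) \<le> \<delta>"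
  shows "vertex_max m v u \<le> vertex_max m w u + \<delta> * norm u"
proof -
  obtain j where j: "j < m" "vertex_max m v u = v j \<bullet> u"
    using vertex_max_attained[OF assms(1)] by metis
  have "w j \<bullet> u \<le> vertex_max m w u"
    unfolding vertex_max_def using j by (intro Max_ge) auto
  moreover have "(v j - w j) \<bullet> u \<le> \<delta> * norm u"
    using norm_cauchy_schwarz[of "v j - w j" u] assms(2)[OF j(1)]
    by (meson mult_right_mono norm_ge_zero order_trans)
  ultimately show ?thesis by (simp add: j(2) inner_diff_left)
qed

lemma tendsto_vertex_max:
  assumes "1 \<le> m" "\<And>j. j < m \<Longrightarrow> (\<lambda>k. V k j) \<longlonglongrightarrow> v j"
  shows "(\<lambda>k. vertex_max m (V k) u) \<longlonglongrightarrow> vertex_max m v u"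
proof -
  define \<delta> where "\<delta> k = (\<Sum>j<m. norm (V k j - v j))" for k
  have "(\<lambda>k. \<delta> k * norm u) \<longlonglongrightarrow> (\<Sum>j<m. norm (v j - v j)) * norm u"
    unfolding \<delta>_def using assms(2) by (intro tendsto_intros) auto
  then have lim: "(\<lambda>k. \<delta> k * norm u) \<longlonglongrightarrow> 0" by simp
  have \<delta>: "norm (V k j - v j) \<le> \<delta> k" if "j < m" for j k
    unfolding \<delta>_def using that by (intro member_le_sum[of j "{..<m}" "\<lambda>j. norm (V k j - v j)"]) auto
  have "\<bar>vertex_max m (V k) u - vertex_max m v u\<bar> \<le> \<delta> k * norm u" for k
    using vertex_max_le[OF assms(1), of "V k" v "\<delta> k" u]
      vertex_max_le[OF assms(1), of v "V k" "\<delta> k" u] \<delta>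
    by (simp add: norm_minus_commute abs_le_iff)
  then have "(\<lambda>k. vertex_max m (V k) u - vertex_max m v u) \<longlonglongrightarrow> 0"
    by (intro Lim_null_comparison[OF _ lim]) auto
  then show ?thesis by (simp add: LIM_zero_iff)
qed

lemma borel_measurable_vertex_max [measurable]: "vertex_max m v \<in> borel_measurable borel"
  unfolding vertex_max_def[abs_def] by measurable

text \<open>The functional with index \<open>(i, j, k)\<close> is \<open>v \<mapsto> \<langle>v\<^sub>j - v\<^sub>k, u\<^sub>i\<rangle>\<close> in the coordinates of the vertices.\<close>

definition argmax_patterns :: "nat \<Rightarrow> nat \<Rightarrow> (nat \<Rightarrow> 'a::euclidean_space) \<Rightarrow> (nat \<times> nat \<times> nat) set set" where
  "argmax_patterns n m u = sign_patterns ({1..n} \<times> {..<m} \<times> {..<m}) ({..<m} \<times> Basis)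
     (\<lambda>(i, j, k) (l, b). (if l = j then b \<bullet> u i else 0) - (if l = k then b \<bullet> u i else 0))"

text \<open>The choice depends on the pattern alone, not on \<open>v\<close>. All configurations
  with one pattern then share a maximising index at each design point, where their support functions
  are linear in \<open>v\<close>.\<close>

definition pattern_argmax :: "nat \<Rightarrow> (nat \<times> nat \<times> nat) set \<Rightarrow> nat \<Rightarrow> nat" where
  "pattern_argmax m A i = (SOME j. j < m \<and> (\<forall>k<m. (i, j, k) \<in> A))"

lemma finite_argmax_patterns: "finite (argmax_patterns n m u)"
  unfolding argmax_patterns_def by (intro finite_sign_patterns) auto

lemma card_argmax_patterns_le:
  fixes u :: "nat \<Rightarrow> 'a::euclidean_space"
  shows "card (argmax_patterns n m u) \<le> (n * m\<^sup>2 + 1) ^ (m * DIM('a))"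
  using card_sign_patterns_le[of "{1..n} \<times> {..<m} \<times> {..<m}" "{..<m} \<times> (Basis :: 'a set)"]
  unfolding argmax_patterns_def by (simp add: card_cartesian_product power2_eq_square)

lemma vertex_max_eq_pattern_argmax:
  fixes u :: "nat \<Rightarrow> 'a::euclidean_space"
  assumes "1 \<le> m"
  shows "\<exists>A\<in>argmax_patterns n m u. \<forall>i\<in>{1..n}.
           pattern_argmax m A i < m \<and> vertex_max m v (u i) = v (pattern_argmax m A i) \<bullet> u i"
proof -
  define A where "A = {x \<in> {1..n} \<times> {..<m} \<times> {..<m}. case x of (i, j, k) \<Rightarrow> v k \<bullet> u i \<le> v j \<bullet> u i}"
  define c where "c = (\<lambda>(l::nat, b::'a). v l \<bullet> b)"
  have *: "(\<Sum>x\<in>{..<m} \<times> Basis. (case x of (l, b) \<Rightarrow> (if l = j then b \<bullet> u i else 0) - (if l = k then b \<bullet> u i else 0)) * c x)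
      = v j \<bullet> u i - v k \<bullet> u i" if "j < m" "k < m" for i j k
  proof -
    have "(\<Sum>x\<in>{..<m} \<times> Basis. (case x of (l, b) \<Rightarrow> (if l = j then b \<bullet> u i else 0) - (if l = k then b \<bullet> u i else 0)) * c x)
      = (\<Sum>l<m. \<Sum>b\<in>Basis. ((if l = j then b \<bullet> u i else 0) - (if l = k then b \<bullet> u i else 0)) * (v l \<bullet> b))"
      by (simp add: sum.cartesian_product c_def case_prod_beta)
    also have "\<dots> = (\<Sum>l<m. (if l = j then v l \<bullet> u i else 0) - (if l = k then v l \<bullet> u i else 0))"
      by (intro sum.cong refl) (auto simp: sum_Basis_inner sum_negf inner_commute)
    also have "\<dots> = v j \<bullet> u i - v k \<bullet> u i"
      using that by (simp add: sum_subtractf)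
    finally show ?thesis .
  qed
  have "A \<in> argmax_patterns n m u"
    unfolding argmax_patterns_def sign_patterns_def A_def
    by (rule range_eqI[where x = c]) (use * in auto)
  moreover have "pattern_argmax m A i < m \<and> vertex_max m v (u i) = v (pattern_argmax m A i) \<bullet> u i"
    if i: "i \<in> {1..n}" for i
  proof -
    obtain j where "j < m" "\<And>k. k < m \<Longrightarrow> v k \<bullet> u i \<le> v j \<bullet> u i"
      using vertex_max_attained[OF assms, of v "u i"] by metis
    then have "j < m \<and> (\<forall>k<m. (i, j, k) \<in> A)" using i by (auto simp: A_def)
    then have "pattern_argmax m A i < m \<and> (\<forall>k<m. (i, pattern_argmax m A i, k) \<in> A)"
      unfolding pattern_argmax_def by (rule someI)
    then show ?thesis by (auto simp: A_def intro!: vertex_max_eqI)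
  qed
  ultimately show ?thesis by blast
qed

text \<open>The cross term between noise and estimator, minus the quarter of the squared distance
  that the loss can spare; without this subtraction the supremum over \<open>v\<close> could be
  infinite.\<close>

definition noise_gain ::
  "nat \<Rightarrow> (nat \<Rightarrow> 'a::euclidean_space) \<Rightarrow> ('a \<Rightarrow> real) \<Rightarrow> nat \<Rightarrow> (nat \<Rightarrow> 'a) \<Rightarrow> (nat \<Rightarrow> real) \<Rightarrow> real" where
  "noise_gain m v g n u e =
     (\<Sum>i=1..n. 2 * e i * (vertex_max m v (u i) - g (u i)) - (vertex_max m v (u i) - g (u i))\<^sup>2 / 4)"

text \<open>In orthonormal coordinates the sum decouples, and completing the square in each
  coordinate gives the maximum \<open>4 * (y j)\<^sup>2\<close>, attained at
  \<open>\<gamma> j = 4 * y j\<close>.\<close>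

lemma quadratic_gain_le:
  assumes "finite J" "orthonormal_on T J q"
    and "\<And>i. i \<in> T \<Longrightarrow> x i = (\<Sum>j\<in>J. \<gamma> j * q j i)"
  shows "(\<Sum>i\<in>T. 2 * e i * x i - (x i)\<^sup>2 / 4) \<le> 4 * (\<Sum>j\<in>J. (\<Sum>i\<in>T. e i * q j i)\<^sup>2)"
proof -
  define y where "y j = (\<Sum>i\<in>T. e i * q j i)" for j
  have "(\<Sum>i\<in>T. (x i)\<^sup>2) = (\<Sum>j\<in>J. (\<gamma> j)\<^sup>2)"
    using orthonormal_on_sum_square[OF assms(2,1), of \<gamma>] assms(3) by simp
  moreover have "(\<Sum>i\<in>T. e i * x i) = (\<Sum>j\<in>J. \<gamma> j * y j)"
  proof -
    have "(\<Sum>i\<in>T. e i * x i) = (\<Sum>i\<in>T. \<Sum>j\<in>J. \<gamma> j * (e i * q j i))"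
      using assms(3) by (simp add: sum_distrib_left mult.left_commute)
    then show ?thesis
      by (simp only: sum.swap[of _ J T] sum_distrib_left y_def)
  qed
  ultimately have "(\<Sum>i\<in>T. 2 * e i * x i - (x i)\<^sup>2 / 4) = (\<Sum>j\<in>J. 2 * (\<gamma> j * y j) - (\<gamma> j)\<^sup>2 / 4)"
    by (simp add: sum_subtractf sum_distrib_left[symmetric] sum_divide_distrib[symmetric] mult.assoc)
  also have "\<dots> \<le> (\<Sum>j\<in>J. 4 * (y j)\<^sup>2)"
  proof (rule sum_mono)
    fix j
    have "4 * (y j)\<^sup>2 - (2 * (\<gamma> j * y j) - (\<gamma> j)\<^sup>2 / 4) = (2 * y j - \<gamma> j / 2)\<^sup>2"
      by (simp add: power2_eq_square algebra_simps)
    then show "2 * (\<gamma> j * y j) - (\<gamma> j)\<^sup>2 / 4 \<le> 4 * (y j)\<^sup>2"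
      by (metis diff_ge_0_iff_ge zero_le_power2)
  qed
  finally show ?thesis by (simp add: y_def sum_distrib_left)
qed

text \<open>On a fixed argmax pattern the vectors \<open>(h\<^sub>P (u\<^sub>i) - g (u\<^sub>i))\<^sub>i\<close> lie in a linear subspace of
  dimension at most \<open>m d + 1\<close>, so the noise enters only through its projection to that subspace.\<close>

lemma pattern_subspace:
  fixes u :: "nat \<Rightarrow> 'a::euclidean_space"
  shows "\<exists>(J :: (nat \<times> 'a) option set) q. finite J \<and> card J \<le> m * DIM('a) + 1 \<and> orthonormal_on {1..n} J q \<and>
    (\<forall>v e. (\<forall>i\<in>{1..n}. a i < m \<and> vertex_max m v (u i) = v (a i) \<bullet> u i) \<longrightarrow>
        noise_gain m v g n u e \<le> 4 * (\<Sum>j\<in>J. (\<Sum>i=1..n. e i * q j i)\<^sup>2))"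
proof -
  \<comment> \<open>\<open>Some\<close> indexes the coordinates of the vertices and
    \<open>None\<close> the single direction of \<open>g\<close>, which accounts for the
    \<open>+ 1\<close> in the dimension.\<close>
  define I :: "(nat \<times> 'a) option set" where "I = insert None (Some ` ({..<m} \<times> Basis))"
  define w :: "(nat \<times> 'a) option \<Rightarrow> nat \<Rightarrow> real"
    where "w x i = (case x of None \<Rightarrow> g (u i) | Some (l, b) \<Rightarrow> if a i = l then b \<bullet> u i else 0)" for x i
  have fI: "finite I" by (simp add: I_def)
  have cI: "card I = m * DIM('a) + 1"
    unfolding I_def by (subst card_insert_disjoint) (auto simp: card_image card_cartesian_product)
  obtain J q c where J: "J \<subseteq> I" "orthonormal_on {1..n} J q"
    and w: "\<And>k t. k \<in> I \<Longrightarrow> t \<in> {1..n} \<Longrightarrow> w k t = (\<Sum>j\<in>J. c k j * q j t)"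
    using ex_orthonormal_on[OF fI finite_atLeastAtMost, of 1 n w] by blast
  have finJ: "finite J" using J fI finite_subset by blast
  have "noise_gain m v g n u e \<le> 4 * (\<Sum>j\<in>J. (\<Sum>i=1..n. e i * q j i)\<^sup>2)"
    if v: "\<forall>i\<in>{1..n}. a i < m \<and> vertex_max m v (u i) = v (a i) \<bullet> u i" for v e
  proof -
    define \<theta> where "\<theta> x = (case x of None \<Rightarrow> - 1 | Some (l, b) \<Rightarrow> v l \<bullet> b)" for x :: "(nat \<times> 'a) option"
    have "vertex_max m v (u i) - g (u i) = (\<Sum>j\<in>J. (\<Sum>x\<in>I. \<theta> x * c x j) * q j i)" if i: "i \<in> {1..n}" for i
    proof -
      have "(\<Sum>x\<in>I. \<theta> x * w x i) = - g (u i) + (\<Sum>x\<in>{..<m} \<times> Basis. \<theta> (Some x) * w (Some x) i)"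
        unfolding I_def by (subst sum.insert) (auto simp: sum.reindex \<theta>_def w_def)
      also have "(\<Sum>x\<in>{..<m} \<times> Basis. \<theta> (Some x) * w (Some x) i)
          = (\<Sum>l<m. \<Sum>b\<in>Basis. (v l \<bullet> b) * (if a i = l then b \<bullet> u i else 0))"
        by (simp add: sum.cartesian_product \<theta>_def w_def case_prod_beta)
      also have "\<dots> = (\<Sum>l<m. if a i = l then v l \<bullet> u i else 0)"
        by (intro sum.cong refl) (auto simp: sum_Basis_inner inner_commute)
      also have "\<dots> = v (a i) \<bullet> u i"
        using v i by simp
      finally have "vertex_max m v (u i) - g (u i) = (\<Sum>x\<in>I. \<theta> x * w x i)"
        using v i by simp
      also have "\<dots> = (\<Sum>x\<in>I. \<Sum>j\<in>J. \<theta> x * c x j * q j i)"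
        using w i by (simp add: sum_distrib_left mult.assoc)
      also have "\<dots> = (\<Sum>j\<in>J. (\<Sum>x\<in>I. \<theta> x * c x j) * q j i)"
        by (subst sum.swap) (simp add: sum_distrib_right)
      finally show ?thesis .
    qed
    from quadratic_gain_le[OF finJ J(2) this] show ?thesis
      by (simp add: noise_gain_def)
  qed
  moreover have "card J \<le> m * DIM('a) + 1"
    using card_mono[OF fI J(1)] cI by simp
  ultimately show ?thesis using finJ J(2) by blast
qed

text \<open>\<open>ennreal\<close> truncates at 0, so the integrand is a supremum of positive parts.
  It is dominated by a sum over the argmax patterns of exponentials whose integrals are known
  exactly. The set \<open>V\<close> is arbitrary, since the supremum enters only through
  monotonicity.\<close>

lemma nn_integral_excess_le:
  fixes u :: "nat \<Rightarrow> 'a::euclidean_space"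
  assumes "0 < \<sigma>" "1 \<le> m"
  shows "(\<integral>\<^sup>+e. (SUP v\<in>V. ennreal (noise_gain m v g n u e - p)) \<partial>(\<Pi>\<^sub>M i\<in>{1..n}. gauss \<sigma>))
    \<le> ennreal (real (n * m\<^sup>2 + 1) ^ (m * DIM('a)) * (16 * \<sigma>\<^sup>2 * exp (- p / (16 * \<sigma>\<^sup>2)) * sqrt 2 ^ (m * DIM('a) + 1)))"
proof -
  define G where "G = (\<Pi>\<^sub>M i\<in>{1..n}. gauss \<sigma>)"
  define N where "N = argmax_patterns n m u"
  define R where "R A J q \<longleftrightarrow> finite J \<and> card J \<le> m * DIM('a) + 1 \<and> orthonormal_on {1..n} J q \<and>
      (\<forall>v e. (\<forall>i\<in>{1..n}. pattern_argmax m A i < m \<and> vertex_max m v (u i) = v (pattern_argmax m A i) \<bullet> u i) \<longrightarrow>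
        noise_gain m v g n u e \<le> 4 * (\<Sum>j\<in>J. (\<Sum>i=1..n. e i * q j i)\<^sup>2))"
    for A and J :: "(nat \<times> 'a) option set" and q
  have "\<exists>J q. R A J q" for A
    unfolding R_def by (rule pattern_subspace)
  then obtain J q where "\<And>A. R A (J A) (q A)"
    by metis
  then have fJ: "finite (J A)"
    and cJ: "card (J A) \<le> m * DIM('a) + 1"
    and oJ: "orthonormal_on {1..n} (J A) (q A)"
    and gJ: "(\<forall>i\<in>{1..n}. pattern_argmax m A i < m \<and> vertex_max m v (u i) = v (pattern_argmax m A i) \<bullet> u i) \<Longrightarrow>
        noise_gain m v g n u e \<le> 4 * (\<Sum>j\<in>J A. (\<Sum>i=1..n. e i * q A j i)\<^sup>2)" for A v e
    unfolding R_def by blast+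
  define S where "S A e = (\<Sum>j\<in>J A. (\<Sum>i=1..n. e i * q A j i)\<^sup>2)" for A e
  define c where "c = 16 * \<sigma>\<^sup>2 * exp (- p / (16 * \<sigma>\<^sup>2))"
  have c0: "0 \<le> c" by (simp add: c_def)
  have "(SUP v\<in>V. ennreal (noise_gain m v g n u e - p))
      \<le> (\<Sum>A\<in>N. ennreal c * ennreal (exp (S A e / (4 * \<sigma>\<^sup>2))))" for e
  proof (rule SUP_least)
    fix v
    obtain A where A: "A \<in> N"
      "\<forall>i\<in>{1..n}. pattern_argmax m A i < m \<and> vertex_max m v (u i) = v (pattern_argmax m A i) \<bullet> u i"
      using vertex_max_eq_pattern_argmax[OF assms(2), of n u v] unfolding N_def by blast
    define y where "y = noise_gain m v g n u e - p"
    have "y \<le> 4 * S A e - p"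
      using gJ[OF A(2), of e] by (simp add: y_def S_def)
    then have "y / (16 * \<sigma>\<^sup>2) \<le> (4 * S A e - p) / (16 * \<sigma>\<^sup>2)"
      by (intro divide_right_mono) auto
    also have "\<dots> = - p / (16 * \<sigma>\<^sup>2) + S A e / (4 * \<sigma>\<^sup>2)"
      using assms(1) by (simp add: field_simps)
    finally have "exp (y / (16 * \<sigma>\<^sup>2)) \<le> exp (- p / (16 * \<sigma>\<^sup>2)) * exp (S A e / (4 * \<sigma>\<^sup>2))"
      by (simp only: exp_add[symmetric] exp_le_cancel_iff)
    \<comment> \<open>The positive part is replaced by an exponential. The scale 16 is 4 times 4: it
      turns the gain \<open>4 * S A e\<close> into the exponent
      \<open>S A e / (4 * \<sigma>\<^sup>2)\<close> of the moment formula.\<close>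
    moreover have "y / (16 * \<sigma>\<^sup>2) \<le> exp (y / (16 * \<sigma>\<^sup>2))"
      using exp_ge_add_one_self[of "y / (16 * \<sigma>\<^sup>2)"] by linarith
    ultimately have "y / (16 * \<sigma>\<^sup>2) \<le> exp (- p / (16 * \<sigma>\<^sup>2)) * exp (S A e / (4 * \<sigma>\<^sup>2))"
      by linarith
    then have "y \<le> c * exp (S A e / (4 * \<sigma>\<^sup>2))"
      using assms(1) by (simp add: pos_divide_le_eq c_def ac_simps)
    then have "ennreal y \<le> ennreal c * ennreal (exp (S A e / (4 * \<sigma>\<^sup>2)))"
      using c0 by (simp add: ennreal_mult'[symmetric])
    also have "\<dots> \<le> (\<Sum>A\<in>N. ennreal c * ennreal (exp (S A e / (4 * \<sigma>\<^sup>2))))"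
      using A(1) finite_argmax_patterns[of n m u] unfolding N_def
      by (intro member_le_sum[of A _ "\<lambda>A. ennreal c * ennreal (exp (S A e / (4 * \<sigma>\<^sup>2)))"]) auto
    finally show "ennreal (noise_gain m v g n u e - p) \<le> (\<Sum>A\<in>N. ennreal c * ennreal (exp (S A e / (4 * \<sigma>\<^sup>2))))"
      by (simp add: y_def)
  qed
  then have "(\<integral>\<^sup>+e. (SUP v\<in>V. ennreal (noise_gain m v g n u e - p)) \<partial>G)
      \<le> (\<integral>\<^sup>+e. (\<Sum>A\<in>N. ennreal c * ennreal (exp (S A e / (4 * \<sigma>\<^sup>2)))) \<partial>G)"
    by (intro nn_integral_mono)
  also have "\<dots> = (\<Sum>A\<in>N. ennreal c * (\<integral>\<^sup>+e. ennreal (exp (S A e / (4 * \<sigma>\<^sup>2))) \<partial>G))"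
    unfolding G_def S_def by (subst nn_integral_sum) (auto simp: nn_integral_cmult)
  also have "\<dots> = (\<Sum>A\<in>N. ennreal c * ennreal (sqrt 2 ^ card (J A)))"
    using nn_integral_exp_projection[OF assms(1) finite_atLeastAtMost fJ oJ]
    unfolding G_def S_def by simp
  also have "\<dots> \<le> (\<Sum>A\<in>N. ennreal (c * sqrt 2 ^ (m * DIM('a) + 1)))"
  proof (rule sum_mono)
    fix A
    have "sqrt 2 ^ card (J A) \<le> sqrt 2 ^ (m * DIM('a) + 1)"
      by (rule power_increasing[OF cJ]) simp
    then have "c * sqrt 2 ^ card (J A) \<le> c * sqrt 2 ^ (m * DIM('a) + 1)"
      using c0 by (rule mult_left_mono)
    then show "ennreal c * ennreal (sqrt 2 ^ card (J A)) \<le> ennreal (c * sqrt 2 ^ (m * DIM('a) + 1))"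
      using c0 by (simp add: ennreal_mult'[symmetric] ennreal_leI)
  qed
  also have "\<dots> = ennreal (real (card N) * (c * sqrt 2 ^ (m * DIM('a) + 1)))"
    using c0 by (simp add: ennreal_of_nat_eq_real_of_nat ennreal_mult'[symmetric])
  also have "\<dots> \<le> ennreal (real (n * m\<^sup>2 + 1) ^ (m * DIM('a)) * (c * sqrt 2 ^ (m * DIM('a) + 1)))"
  proof (intro ennreal_leI mult_right_mono)
    show "real (card N) \<le> real (n * m\<^sup>2 + 1) ^ (m * DIM('a))"
      using card_argmax_patterns_le[of n m u] unfolding N_def by (metis of_nat_le_iff of_nat_power)
  qed (use c0 in auto)
  finally show ?thesis by (simp add: G_def c_def)
qed

text \<open>Finite lists over a countable dense set, read as functions by \<open>(!)\<close>. Lists,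
  unlike sequences, are countably many, and the values beyond the length are irrelevant. One set
  serves all \<open>m\<close>.\<close>

lemma ex_countable_vertices:
  "\<exists>V :: (nat \<Rightarrow> 'a::euclidean_space) set. countable V \<and>
     (\<forall>m v. \<exists>W. range W \<subseteq> V \<and> (\<forall>j<m. (\<lambda>k::nat. W k j) \<longlonglongrightarrow> v j))"
proof -
  obtain X :: "'a set" where X: "countable X" "\<And>S. open S \<Longrightarrow> S \<noteq> {} \<Longrightarrow> \<exists>x\<in>X. x \<in> S"
    using countable_dense_setE by metis
  have "\<exists>W. range W \<subseteq> (!) ` lists X \<and> (\<forall>j<m. (\<lambda>k::nat. W k j) \<longlonglongrightarrow> v j)" for m :: nat and v :: "nat \<Rightarrow> 'a"
  proof -
    have "\<exists>x\<in>X. dist x (v j) < inverse (real (Suc k))" for j k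
      using X(2)[of "ball (v j) (inverse (real (Suc k)))"] by (auto simp: dist_commute)
    then obtain x where x: "\<And>j k. x j k \<in> X" "\<And>j k. dist (x j k) (v j) < inverse (real (Suc k))"
      by metis
    have "(\<lambda>k. x j k) \<longlonglongrightarrow> v j" for j
    proof (rule metric_tendsto_imp_tendsto[of "\<lambda>k. inverse (real (Suc k))" 0])
      show "\<forall>\<^sub>F k in sequentially. dist (x j k) (v j) \<le> dist (inverse (real (Suc k))) 0"
        using x(2) less_imp_le by (intro always_eventually) (auto simp: dist_norm)
    qed (rule LIMSEQ_inverse_real_of_nat)
    then show ?thesis
      using x(1) by (intro exI[of _ "\<lambda>k. (!) (map (\<lambda>j. x j k) [0..<m])"]) (auto intro!: imageI)
  qed
  moreover have "countable ((!) ` lists X)"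
    using X(1) by (intro countable_image countable_lists)
  ultimately show ?thesis by blast
qed

text \<open>A countable index set keeps the suprema over all vertex configurations measurable.\<close>

definition vertex_net :: "(nat \<Rightarrow> 'a::euclidean_space) set" where
  "vertex_net = (SOME V. countable V \<and>
     (\<forall>m v. \<exists>W. range W \<subseteq> V \<and> (\<forall>j<m. (\<lambda>k::nat. W k j) \<longlonglongrightarrow> v j)))"

lemma vertex_net:
  "countable (vertex_net :: (nat \<Rightarrow> 'a::euclidean_space) set)"
  "\<exists>W. range W \<subseteq> (vertex_net :: (nat \<Rightarrow> 'a) set) \<and> (\<forall>j<m. (\<lambda>k::nat. W k j) \<longlonglongrightarrow> v j)"
  using someI_ex[OF ex_countable_vertices[where 'a='a], folded vertex_net_def] by blast+

text \<open>The gain is continuous in the first \<open>m\<close> vertices, so density of the net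
  transfers the supremum to any configuration, in particular to one chosen from the data.\<close>

lemma noise_gain_le_SUP:
  assumes "1 \<le> m"
  shows "ennreal (noise_gain m v g n u e - p) \<le> (SUP w\<in>vertex_net. ennreal (noise_gain m w g n u e - p))"
proof -
  obtain W where W: "range W \<subseteq> vertex_net" "\<And>j. j < m \<Longrightarrow> (\<lambda>k::nat. W k j) \<longlonglongrightarrow> v j"
    using vertex_net(2)[where m = m and v = v] by blast
  have "(\<lambda>k. noise_gain m (W k) g n u e - p) \<longlonglongrightarrow> noise_gain m v g n u e - p"
    unfolding noise_gain_def by (intro tendsto_intros tendsto_vertex_max assms W) auto
  then have "(\<lambda>k. ennreal (noise_gain m (W k) g n u e - p)) \<longlonglongrightarrow> ennreal (noise_gain m v g n u e - p)"
    by (rule tendsto_ennrealI)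
  then show ?thesis
    by (rule LIMSEQ_le_const2) (use W(1) in \<open>auto intro!: SUP_upper exI[of _ 0]\<close>)
qed

text \<open>The design law carries the trace sigma-algebra of the sphere; the first assumption says
  that the inclusion into the whole space is Borel.\<close>

lemma measurable_noise_gain:
  assumes [measurable]: "(\<lambda>x. x) \<in> borel_measurable \<nu>" "g \<in> borel_measurable borel"
  shows "(\<lambda>(u, e). noise_gain m v g n u e) \<in> borel_measurable ((\<Pi>\<^sub>M i\<in>{1..n}. \<nu>) \<Otimes>\<^sub>M (\<Pi>\<^sub>M i\<in>{1..n}. borel))"
proof -
  have [measurable]: "(\<lambda>\<omega>. fst \<omega> i) \<in> borel_measurable ((\<Pi>\<^sub>M i\<in>{1..n}. \<nu>) \<Otimes>\<^sub>M (\<Pi>\<^sub>M i\<in>{1..n}. borel :: real measure))"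
    if [measurable]: "i \<in> {1..n}" for i
    by (rule measurable_compose[OF _ assms(1)]) measurable
  show ?thesis
    unfolding noise_gain_def case_prod_beta by measurable
qed

subsection \<open>Risk of the selected estimator\<close>

text \<open>This is \<open>n\<close> times the penalty in the selection criterion.\<close>

definition penalty :: "real \<Rightarrow> real \<Rightarrow> nat \<Rightarrow> nat \<Rightarrow> nat \<Rightarrow> real" where
  "penalty \<kappa> \<sigma> d n m = 48 * \<sigma>\<^sup>2 * real m * real d * ln (3 * real m) * (9 * 2 ^ 15 * \<kappa> * ln (real n) + 1)"

section \<open>The penalty against the expected noise\<close>

lemma one_le_ln_3: "1 \<le> ln (3 * real m)" if "1 \<le> m"
proof -
  have "exp 1 \<le> (3::real)" by (rule exp_le)
  also have "\<dots> \<le> 3 * real m" using that by simp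
  finally show ?thesis using that by (subst ln_ge_iff) auto
qed

lemma one_le_ln_n: "1 \<le> ln (real n)" if "7 \<le> n"
proof -
  have "exp 1 \<le> (3::real)" by (rule exp_le)
  also have "\<dots> \<le> real n" using that by simp
  finally show ?thesis using that by (subst ln_ge_iff) auto
qed

text \<open>All exponents are compared with \<open>X = m d ln n ln (3 m)\<close>: the number of
  patterns contributes at most \<open>3 * X\<close>, the dimension at most \<open>X\<close>, the
  penalty at least \<open>5 * X\<close>. The remaining \<open>exp (- X)\<close> is at most
  \<open>(1 / 2) ^ m\<close>, which is summable over \<open>m\<close>.\<close>

lemma excess_bound_le:
  assumes "1 \<le> \<kappa>" "0 < \<sigma>" "7 \<le> n" "1 \<le> m" "1 \<le> d"
  shows "real (n * m\<^sup>2 + 1) ^ (m * d) *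
      (16 * \<sigma>\<^sup>2 * exp (- penalty \<kappa> \<sigma> d n m / (16 * \<sigma>\<^sup>2)) * sqrt 2 ^ (m * d + 1))
    \<le> 16 * \<sigma>\<^sup>2 * (1 / 2) ^ m"
proof -
  define L where "L = ln (3 * real m)"
  define l where "l = ln (real n)"
  have L: "1 \<le> L" unfolding L_def by (rule one_le_ln_3[OF assms(4)])
  have l: "1 \<le> l" unfolding l_def by (rule one_le_ln_n[OF assms(3)])
  have lL: "1 \<le> l * L" "l \<le> l * L" "L \<le> l * L"
    using mult_mono[OF l L] mult_left_mono[OF L, of l] mult_right_mono[OF l, of L] l L by auto
  define X where "X = real m * real d * (l * L)"
  have md: "1 \<le> real m * real d"
    using mult_mono[of 1 "real m" 1 "real d"] assms(4,5) by simp
  have mX: "real m * real d \<le> X" "real m \<le> real m * real d"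
    using mult_left_mono[OF lL(1), of "real m * real d"] mult_left_mono[of 1 "real d" "real m"] assms
    by (auto simp: X_def)
  have X0: "0 \<le> X" using mX md by linarith
  have "1 * 1 \<le> n * m\<^sup>2" using assms by (intro mult_mono) auto
  \<comment> \<open>The \<open>+ 1\<close> is absorbed by passing from \<open>m\<close> to
    \<open>3 * m\<close>, so that the logarithm of the bound is \<open>l + 2 * L\<close>.\<close>
  then have "real (n * m\<^sup>2 + 1) \<le> real (n * (3 * m)\<^sup>2)"
    unfolding of_nat_le_iff by (simp add: power_mult_distrib)
  also have "\<dots> = exp (l + 2 * L)"
    using assms by (simp add: l_def L_def exp_add exp_double)
  also have "\<dots> \<le> exp (3 * (l * L))"
    using lL by simp
  finally have "real (n * m\<^sup>2 + 1) ^ (m * d) \<le> exp (3 * (l * L)) ^ (m * d)"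
    by (intro power_mono) auto
  then have b1: "real (n * m\<^sup>2 + 1) ^ (m * d) \<le> exp (3 * X)"
    by (simp add: exp_of_nat_mult[symmetric] X_def ac_simps)
  have "sqrt 2 \<le> exp (1 / 2 :: real)"
  proof (rule real_le_lsqrt)
    have "(exp (1 / 2 :: real))\<^sup>2 = exp 1" by (simp add: exp_double[symmetric])
    then show "2 \<le> (exp (1 / 2 :: real))\<^sup>2" using exp_ge_add_one_self[of "1::real"] by simp
  qed auto
  then have "sqrt 2 ^ (m * d + 1) \<le> exp (1 / 2) ^ (m * d + 1)"
    by (intro power_mono) auto
  also have "\<dots> = exp (real (m * d + 1) / 2)"
    unfolding exp_of_nat_mult[symmetric] by simp
  also have "\<dots> \<le> exp X"
    using md mX by simp
  finally have b2: "sqrt 2 ^ (m * d + 1) \<le> exp X" .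
  \<comment> \<open>884736 is 3 times \<open>9 * 2 ^ 15\<close>, the leading coefficient of the
    penalty after division by \<open>16 * \<sigma>\<^sup>2\<close>.\<close>
  have "X + X * 884735 \<le> 3 * real m * real d * L * (9 * 2 ^ 15 * \<kappa> * l + 1)"
  proof -
    have "X \<le> X * \<kappa>" using mult_left_mono[OF assms(1) X0] by simp
    moreover have "3 * real m * real d * L * (9 * 2 ^ 15 * \<kappa> * l + 1) = 884736 * (X * \<kappa>) + 3 * (real m * real d) * L"
      by (simp add: X_def algebra_simps)
    moreover have "0 \<le> 3 * (real m * real d) * L" using md L by simp
    ultimately show ?thesis by linarith
  qed
  also have "\<dots> = penalty \<kappa> \<sigma> d n m / (16 * \<sigma>\<^sup>2)"
    using assms(2) by (simp add: penalty_def L_def l_def field_simps)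
  finally have "exp (- penalty \<kappa> \<sigma> d n m / (16 * \<sigma>\<^sup>2)) \<le> exp (- 5 * X)"
    using X0 by simp
  then have "real (n * m\<^sup>2 + 1) ^ (m * d) * (exp (- penalty \<kappa> \<sigma> d n m / (16 * \<sigma>\<^sup>2)) * sqrt 2 ^ (m * d + 1))
      \<le> exp (3 * X) * (exp (- 5 * X) * exp X)"
    using b1 b2 by (intro mult_mono) auto
  also have "\<dots> = exp (- X)" by (simp add: exp_add[symmetric])
  also have "\<dots> \<le> exp (real m * (- 1))" using mX by simp
  also have "\<dots> = exp (- 1) ^ m" by (rule exp_of_nat_mult)
  also have "\<dots> \<le> (1 / 2) ^ m"
    using exp_ge_add_one_self[of "1::real"] by (intro power_mono) (auto simp: exp_minus field_simps)
  finally have "16 * \<sigma>\<^sup>2 * (real (n * m\<^sup>2 + 1) ^ (m * d) *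
      (exp (- penalty \<kappa> \<sigma> d n m / (16 * \<sigma>\<^sup>2)) * sqrt 2 ^ (m * d + 1))) \<le> 16 * \<sigma>\<^sup>2 * (1 / 2) ^ m"
    by (rule mult_left_mono) simp
  then show ?thesis by (simp only: ac_simps)
qed

lemma ennreal_add_le:
  assumes "0 \<le> a"
  shows "ennreal (a + b) \<le> ennreal a + ennreal b"
proof (cases "0 \<le> b")
  case True
  then show ?thesis using assms by simp
next
  case False
  then have "ennreal (a + b) \<le> ennreal a" by (intro ennreal_leI) simp
  then show ?thesis by (simp add: add_increasing2)
qed

text \<open>Summing over all indices dominates the value at whichever index the data select. The
  shift by \<open>Suc\<close> skips the empty class of index 0.\<close>

definition excess ::
  "real \<Rightarrow> real \<Rightarrow> nat \<Rightarrow> ('a::euclidean_space \<Rightarrow> real) \<Rightarrow> (nat \<Rightarrow> 'a) \<Rightarrow> (nat \<Rightarrow> real) \<Rightarrow> ennreal" where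
  "excess \<kappa> \<sigma> n g u e =
     (\<Sum>m. SUP v\<in>vertex_net. ennreal (noise_gain (Suc m) v g n u e - penalty \<kappa> \<sigma> DIM('a) n (Suc m)))"

lemma noise_gain_le_excess:
  fixes g :: "'a::euclidean_space \<Rightarrow> real"
  assumes "1 \<le> m"
  shows "ennreal (noise_gain m v g n u e - penalty \<kappa> \<sigma> DIM('a) n m) \<le> excess \<kappa> \<sigma> n g u e"
proof -
  obtain k where k: "m = Suc k" using assms by (cases m) auto
  have "ennreal (noise_gain m v g n u e - penalty \<kappa> \<sigma> DIM('a) n m)
      \<le> (SUP v\<in>vertex_net. ennreal (noise_gain (Suc k) v g n u e - penalty \<kappa> \<sigma> DIM('a) n (Suc k)))"
    using noise_gain_le_SUP[OF assms] unfolding k .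
  also have "\<dots> \<le> excess \<kappa> \<sigma> n g u e"
    unfolding excess_def
    using sum_le_suminf[OF summableI, of "{k}" "\<lambda>m. SUP v\<in>vertex_net. ennreal (noise_gain (Suc m) v g n u e - penalty \<kappa> \<sigma> DIM('a) n (Suc m))"]
    by simp
  finally show ?thesis .
qed

text \<open>The geometric bounds sum to 1 over \<open>m \<ge> 1\<close>. The result is uniform in
  the design \<open>u\<close>, so averaging over the design preserves it.\<close>

lemma nn_integral_excess_sum_le:
  fixes g :: "'a::euclidean_space \<Rightarrow> real"
  assumes "1 \<le> \<kappa>" "0 < \<sigma>" "7 \<le> n"
  shows "(\<integral>\<^sup>+e. excess \<kappa> \<sigma> n g u e \<partial>(\<Pi>\<^sub>M i\<in>{1..n}. gauss \<sigma>)) \<le> ennreal (16 * \<sigma>\<^sup>2)"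
proof -
  let ?G = "\<Pi>\<^sub>M i\<in>{1..n}. gauss \<sigma>"
  have [measurable]: "(\<lambda>e. noise_gain m v g n u e) \<in> borel_measurable ?G" for m v
    unfolding noise_gain_def by measurable
  have [measurable]: "(\<lambda>e. SUP v\<in>vertex_net. ennreal (noise_gain m v g n u e - p)) \<in> borel_measurable ?G" for m p
    by (intro borel_measurable_SUP vertex_net(1)) measurable
  have "(\<integral>\<^sup>+e. excess \<kappa> \<sigma> n g u e \<partial>?G)
     = (\<Sum>m. \<integral>\<^sup>+e. (SUP v\<in>vertex_net. ennreal (noise_gain (Suc m) v g n u e - penalty \<kappa> \<sigma> DIM('a) n (Suc m))) \<partial>?G)"
    unfolding excess_def by (rule nn_integral_suminf) measurable
  also have "\<dots> \<le> (\<Sum>m. ennreal (16 * \<sigma>\<^sup>2 * (1 / 2) ^ Suc m))"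
  proof (intro suminf_le summableI)
    fix m
    have "(\<integral>\<^sup>+e. (SUP v\<in>vertex_net. ennreal (noise_gain (Suc m) v g n u e - penalty \<kappa> \<sigma> DIM('a) n (Suc m))) \<partial>?G)
      \<le> ennreal (real (n * (Suc m)\<^sup>2 + 1) ^ (Suc m * DIM('a)) *
          (16 * \<sigma>\<^sup>2 * exp (- penalty \<kappa> \<sigma> DIM('a) n (Suc m) / (16 * \<sigma>\<^sup>2)) * sqrt 2 ^ (Suc m * DIM('a) + 1)))"
      by (rule nn_integral_excess_le[OF assms(2)]) simp
    also have "\<dots> \<le> ennreal (16 * \<sigma>\<^sup>2 * (1 / 2) ^ Suc m)"
      using DIM_positive[where 'a='a] by (intro ennreal_leI excess_bound_le assms) auto
    finally show "(\<integral>\<^sup>+e. (SUP v\<in>vertex_net. ennreal (noise_gain (Suc m) v g n u e - penalty \<kappa> \<sigma> DIM('a) n (Suc m))) \<partial>?G)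
      \<le> ennreal (16 * \<sigma>\<^sup>2 * (1 / 2) ^ Suc m)" .
  qed
  also have "\<dots> = ennreal (16 * \<sigma>\<^sup>2)"
  proof (rule suminf_ennreal_eq)
    show "(\<lambda>m. 16 * \<sigma>\<^sup>2 * (1 / 2) ^ Suc m) sums (16 * \<sigma>\<^sup>2)"
      using sums_mult[OF power_half_series, of "16 * \<sigma>\<^sup>2"] by simp
  qed simp
  finally show ?thesis .
qed

lemma measurable_excess:
  assumes [measurable]: "(\<lambda>x. x) \<in> borel_measurable \<nu>" "g \<in> borel_measurable borel"
  shows "(\<lambda>(u, e). excess \<kappa> \<sigma> n g u e) \<in> borel_measurable ((\<Pi>\<^sub>M i\<in>{1..n}. \<nu>) \<Otimes>\<^sub>M (\<Pi>\<^sub>M i\<in>{1..n}. borel))"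
proof -
  note [measurable] = measurable_noise_gain[OF assms, unfolded case_prod_beta]
  have [measurable]: "(\<lambda>x. SUP v\<in>vertex_net. ennreal (noise_gain m v g n (fst x) (snd x) - p))
      \<in> borel_measurable ((\<Pi>\<^sub>M i\<in>{1..n}. \<nu>) \<Otimes>\<^sub>M (\<Pi>\<^sub>M i\<in>{1..n}. borel))" for m p
    by (intro borel_measurable_SUP vertex_net(1)) measurable
  show ?thesis
    unfolding excess_def case_prod_beta by measurable
qed

text \<open>It suffices to compare both measures on rectangles, whose preimage is the intersection
  of an event of each generated sigma-algebra.\<close>

lemma (in prob_space) distr_pair_indep_set:
  assumes [measurable]: "X \<in> measurable M A" "Y \<in> measurable M B"
    and ind: "indep_set (sets (vimage_algebra (space M) X A)) (sets (vimage_algebra (space M) Y B))"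
  shows "distr M A X \<Otimes>\<^sub>M distr M B Y = distr M (A \<Otimes>\<^sub>M B) (\<lambda>\<omega>. (X \<omega>, Y \<omega>))"
proof (rule pair_measure_eqI)
  interpret X: prob_space "distr M A X" by (rule prob_space_distr) fact
  interpret Y: prob_space "distr M B Y" by (rule prob_space_distr) fact
  show "sigma_finite_measure (distr M A X)" "sigma_finite_measure (distr M B Y)" ..
  show "sets (distr M A X \<Otimes>\<^sub>M distr M B Y) = sets (distr M (A \<Otimes>\<^sub>M B) (\<lambda>\<omega>. (X \<omega>, Y \<omega>)))"
    by (simp cong: sets_pair_measure_cong)
  fix a b assume "a \<in> sets (distr M A X)" "b \<in> sets (distr M B Y)"
  then have [measurable]: "a \<in> sets A" "b \<in> sets B" by auto
  have "prob ((X -` a \<inter> space M) \<inter> (Y -` b \<inter> space M)) = prob (X -` a \<inter> space M) * prob (Y -` b \<inter> space M)"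
    by (intro indep_setD[OF ind] in_vimage_algebra) measurable
  moreover have "(\<lambda>\<omega>. (X \<omega>, Y \<omega>)) -` (a \<times> b) \<inter> space M = (X -` a \<inter> space M) \<inter> (Y -` b \<inter> space M)"
    by auto
  ultimately show "emeasure (distr M A X) a * emeasure (distr M B Y) b =
      emeasure (distr M (A \<Otimes>\<^sub>M B) (\<lambda>\<omega>. (X \<omega>, Y \<omega>))) (a \<times> b)"
    by (simp add: emeasure_distr emeasure_eq_measure ennreal_mult'[symmetric])
qed

text \<open>Conditioning on the design: the errors become an inner integral over i.i.d. Gaussians
  with \<open>u\<close> fixed, where the fixed-design bound applies. Restriction to
  \<open>{1..n}\<close> makes the vectors points of the product space.\<close>

lemma nn_integral_gaussian_design:
  fixes \<nu> :: "'a::euclidean_space measure"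
  assumes "gaussian_design M n \<nu> \<sigma> U \<epsilon>" "1 \<le> n"
    and F: "(\<lambda>(u, e). F u e) \<in> borel_measurable ((\<Pi>\<^sub>M i\<in>{1..n}. \<nu>) \<Otimes>\<^sub>M (\<Pi>\<^sub>M i\<in>{1..n}. borel))"
  shows "(\<integral>\<^sup>+\<omega>. F (\<lambda>i\<in>{1..n}. U i \<omega>) (\<lambda>i\<in>{1..n}. \<epsilon> i \<omega>) \<partial>M)
    = (\<integral>\<^sup>+u. (\<integral>\<^sup>+e. F u e \<partial>(\<Pi>\<^sub>M i\<in>{1..n}. gauss \<sigma>)) \<partial>distr M (\<Pi>\<^sub>M i\<in>{1..n}. \<nu>) (\<lambda>\<omega>. \<lambda>i\<in>{1..n}. U i \<omega>))"
proof -
  let ?T = "{1..n}"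
  let ?A = "\<Pi>\<^sub>M i\<in>?T. \<nu>" and ?B = "\<Pi>\<^sub>M i\<in>?T. (borel :: real measure)"
  let ?X = "\<lambda>\<omega>. \<lambda>i\<in>?T. U i \<omega>" and ?E = "\<lambda>\<omega>. \<lambda>i\<in>?T. \<epsilon> i \<omega>"
  note gd = assms(1)[unfolded gaussian_design_def]
  interpret prob_space M using gd by blast
  have U: "U i \<in> measurable M \<nu>" and \<epsilon> [measurable]: "\<epsilon> i \<in> borel_measurable M" if "i \<in> ?T" for i
    using gd that unfolding indep_vars_def by blast+
  have X [measurable]: "?X \<in> measurable M ?A"
    using U by (intro measurable_restrict) auto
  have E [measurable]: "?E \<in> measurable M ?B"
    by measurable
  have ind: "indep_set (sets (vimage_algebra (space M) ?X ?A)) (sets (vimage_algebra (space M) ?E ?B))"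
    using gd by blast
  interpret E: prob_space "distr M ?B ?E" by (rule prob_space_distr[OF E])
  note joint = distr_pair_indep_set[OF X E ind]
  have "distr M borel (\<epsilon> i) = gauss \<sigma>" if "i \<in> ?T" for i
  proof -
    have "distr M lborel (\<epsilon> i) = gauss \<sigma>"
      using gd that unfolding distributed_def gauss_def by blast
    moreover have "distr M lborel (\<epsilon> i) = distr M borel (\<epsilon> i)"
      by (rule distr_cong) auto
    ultimately show ?thesis by simp
  qed
  moreover have "distr M ?B ?E = (\<Pi>\<^sub>M i\<in>?T. distr M borel (\<epsilon> i))"
    using gd assms(2) by (intro indep_vars_iff_distr_eq_PiM'[THEN iffD1] \<epsilon>) auto
  ultimately have EG: "distr M ?B ?E = (\<Pi>\<^sub>M i\<in>?T. gauss \<sigma>)"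
    by (auto intro: PiM_cong)
  have "(\<integral>\<^sup>+\<omega>. F (?X \<omega>) (?E \<omega>) \<partial>M) = (\<integral>\<^sup>+x. (\<lambda>(u, e). F u e) x \<partial>distr M (?A \<Otimes>\<^sub>M ?B) (\<lambda>\<omega>. (?X \<omega>, ?E \<omega>)))"
    by (subst nn_integral_distr[OF measurable_Pair[OF X E]]) (use F in \<open>simp_all del: One_nat_def\<close>)
  also have "\<dots> = (\<integral>\<^sup>+u. (\<integral>\<^sup>+e. F u e \<partial>distr M ?B ?E) \<partial>distr M ?A ?X)"
    unfolding joint[symmetric] by (subst E.nn_integral_fst[symmetric]) (use F in auto)
  finally show ?thesis unfolding EG .
qed

section \<open>Polytopes as maxima over finitely many vertices\<close>

lemma support_function_convex_hull:
  assumes "1 \<le> m"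
  shows "support_function (convex hull (v ` {..<m})) = vertex_max m v"
proof
  fix u
  obtain j where j: "j < m" "vertex_max m v u = v j \<bullet> u" "\<And>k. k < m \<Longrightarrow> v k \<bullet> u \<le> v j \<bullet> u"
    using vertex_max_attained[OF assms] by metis
  have "convex hull (v ` {..<m}) \<subseteq> {x. u \<bullet> x \<le> v j \<bullet> u}"
    using j by (intro hull_minimal convex_halfspace_le) (auto simp: inner_commute)
  moreover have "v j \<in> convex hull (v ` {..<m})"
    using j(1) by (intro hull_inc) auto
  ultimately show "support_function (convex hull (v ` {..<m})) u = vertex_max m v u"
    unfolding support_function_def j(2)
    by (intro cSup_eq_maximum) (auto simp: inner_commute)
qed

lemma finite_extreme_points_polytope: "polytope P \<Longrightarrow> finite {v. v extreme_point_of P}"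
  unfolding polytope_def using extreme_points_of_convex_hull finite_subset by blast

lemma support_class_enatE:
  assumes "h \<in> support_class (enat m)"
  obtains v where "1 \<le> m" "h = vertex_max m v"
proof -
  obtain P where P: "h = support_function P" "polytope P" "P \<noteq> {}" "card {v. v extreme_point_of P} \<le> m"
    using assms by (auto simp: support_class_def)
  define E where "E = {v. v extreme_point_of P}"
  have PE: "P = convex hull E"
    unfolding E_def using P by (intro Krein_Milman_Minkowski polytope_imp_compact polytope_imp_convex)
  then have E0: "E \<noteq> {}" using P(3) by auto
  have finE: "finite E" unfolding E_def by (rule finite_extreme_points_polytope[OF P(2)])
  obtain f where f: "bij_betw f {0..<card E} E"
    using ex_bij_betw_nat_finite[OF finE] by blast
  have c: "0 < card E" "card E \<le> m"
    using P(4) E0 finE by (auto simp: E_def card_gt_0_iff)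
  \<comment> \<open>If there are fewer than \<open>m\<close> extreme points, the list is padded by
    repeating the first one.\<close>
  define v where "v j = f (if j < card E then j else 0)" for j
  have "v ` {..<m} = E"
  proof
    show "v ` {..<m} \<subseteq> E"
      using c bij_betwE[OF f] by (auto simp: v_def)
    show "E \<subseteq> v ` {..<m}"
    proof
      fix x assume "x \<in> E"
      then have "x \<in> f ` {0..<card E}"
        using bij_betw_imp_surj_on[OF f] by simp
      then obtain j where "j < card E" "x = f j" by auto
      then show "x \<in> v ` {..<m}"
        using c by (intro image_eqI[of _ _ j]) (auto simp: v_def)
    qed
  qed
  then have "h = vertex_max m v"
    using support_function_convex_hull[of m v] c P(1) PE by simp
  then show ?thesis using that c by auto
qed

lemma support_function_convex_hull_in_class:
  assumes "finite S" "S \<noteq> {}" "card S \<le> m"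
  shows "support_function (convex hull S) \<in> support_class (enat m)"
proof -
  have "card {v. v extreme_point_of (convex hull S)} \<le> card S"
    using assms by (intro card_mono extreme_points_of_convex_hull)
  then show ?thesis
    using assms unfolding support_class_def polytope_def by fastforce
qed

text \<open>Adding the sum of the \<open>(y i)\<^sup>2\<close> turns the criterion into a penalised
  residual sum of squares. The selected index beats \<open>k\<close>, and the estimator of index
  \<open>k\<close> beats \<open>g\<close>, so the selected polytope is compared with
  \<open>g\<close> directly. The witness \<open>v\<close> lists its vertices.\<close>

lemma selected_loss_le:
  fixes u :: "nat \<Rightarrow> 'a::euclidean_space"
  assumes "1 \<le> n" "1 \<le> k" "1 \<le> mh"
    and y: "\<And>i. i \<in> {1..n} \<Longrightarrow> y i = support_function K (u i) + e i"
    and ls: "\<And>m. 1 \<le> m \<Longrightarrow> is_least_squares n u y (enat m) (Khat m)"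
    and sel: "is_arg_min (selection_criterion n u y \<kappa> \<sigma> Khat) (\<lambda>m. 1 \<le> m) mh"
    and g: "g \<in> support_class (enat k)"
    and \<beta>: "\<And>i. i \<in> {1..n} \<Longrightarrow> (g (u i) - support_function K (u i))\<^sup>2 \<le> \<beta>"
  shows "\<exists>v. emp_sq_dist n u (Khat mh) K \<le> 3 * \<beta> + 2 * penalty \<kappa> \<sigma> DIM('a) n k / n
    + 2 / n * (noise_gain mh v g n u e - penalty \<kappa> \<sigma> DIM('a) n mh)"
proof -
  let ?T = "{1..n}"
  define t where "t i = support_function K (u i)" for i
  define x where "x i = support_function (Khat mh) (u i)" for i
  define z where "z i = support_function (Khat k) (u i)" for i
  define l where "l i = g (u i)" for i
  let ?p = "penalty \<kappa> \<sigma> DIM('a) n"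
  have n0: "0 < real n" using assms(1) by simp
  obtain v where v: "support_function (Khat mh) = vertex_max mh v"
    using ls[OF assms(3)] support_class_enatE[of "support_function (Khat mh)" mh]
    unfolding is_least_squares_def is_arg_min_def by metis
  have "(\<Sum>i\<in>?T. (y i - z i)\<^sup>2) \<le> (\<Sum>i\<in>?T. (y i - l i)\<^sup>2)"
    using ls[OF assms(2)] g unfolding is_least_squares_def is_arg_min_def z_def l_def
    by (meson linorder_not_less)
  then have ls': "(\<Sum>i\<in>?T. (z i)\<^sup>2) - 2 * (\<Sum>i\<in>?T. y i * z i) \<le> (\<Sum>i\<in>?T. (y i - l i)\<^sup>2) - (\<Sum>i\<in>?T. (y i)\<^sup>2)"
    by (simp add: power2_diff sum.distrib sum_subtractf sum_distrib_left mult.assoc)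
  have crit: "selection_criterion n u y \<kappa> \<sigma> Khat m * n
      = (\<Sum>i\<in>?T. (support_function (Khat m) (u i))\<^sup>2) - 2 * (\<Sum>i\<in>?T. y i * support_function (Khat m) (u i)) + ?p m" for m
    using n0 by (simp add: selection_criterion_def penalty_def field_simps)
  have "selection_criterion n u y \<kappa> \<sigma> Khat mh \<le> selection_criterion n u y \<kappa> \<sigma> Khat k"
    using sel assms(2) unfolding is_arg_min_def by (meson linorder_not_less)
  then have "selection_criterion n u y \<kappa> \<sigma> Khat mh * n \<le> selection_criterion n u y \<kappa> \<sigma> Khat k * n"
    using n0 by (intro mult_right_mono) auto
  then have "(\<Sum>i\<in>?T. (x i)\<^sup>2) - 2 * (\<Sum>i\<in>?T. y i * x i) + ?p mh \<le> (\<Sum>i\<in>?T. (y i - l i)\<^sup>2) - (\<Sum>i\<in>?T. (y i)\<^sup>2) + ?p k"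
    using ls' unfolding crit x_def z_def by linarith
  then have "(\<Sum>i\<in>?T. (y i - x i)\<^sup>2) - (\<Sum>i\<in>?T. (y i - l i)\<^sup>2) \<le> ?p k - ?p mh"
    by (simp add: power2_diff sum.distrib sum_subtractf sum_distrib_left mult.assoc)
  then have a: "(\<Sum>i\<in>?T. (y i - x i)\<^sup>2 - (y i - l i)\<^sup>2) \<le> ?p k - ?p mh"
    by (simp add: sum_subtractf)
  \<comment> \<open>A quarter of \<open>(x i - l i)\<^sup>2\<close> is at most half of
    \<open>(x i - t i)\<^sup>2\<close> plus half of \<open>(l i - t i)\<^sup>2\<close>. Half of the
    loss survives; doubling later yields the factors 3 and 2 of the conclusion.\<close>
  have "(x i - t i)\<^sup>2 / 2 - 3 / 2 * (l i - t i)\<^sup>2 - (2 * e i * (x i - l i) - (x i - l i)\<^sup>2 / 4)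
      \<le> (y i - x i)\<^sup>2 - (y i - l i)\<^sup>2" if "i \<in> ?T" for i
  proof -
    have "(y i - x i)\<^sup>2 - (y i - l i)\<^sup>2 = (x i - t i)\<^sup>2 - (l i - t i)\<^sup>2 - 2 * e i * (x i - l i)"
      using y[OF that] by (simp add: t_def power2_eq_square algebra_simps)
    moreover have "(x i - l i)\<^sup>2 \<le> 2 * (x i - t i)\<^sup>2 + 2 * (l i - t i)\<^sup>2"
    proof -
      have "2 * (x i - t i)\<^sup>2 + 2 * (l i - t i)\<^sup>2 - (x i - l i)\<^sup>2 = (x i + l i - 2 * t i)\<^sup>2"
        by (simp add: power2_eq_square algebra_simps)
      then show ?thesis by (metis diff_ge_0_iff_ge zero_le_power2)
    qed
    ultimately show ?thesis by linarith
  qed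
  then have "(\<Sum>i\<in>?T. (x i - t i)\<^sup>2 / 2 - 3 / 2 * (l i - t i)\<^sup>2 - (2 * e i * (x i - l i) - (x i - l i)\<^sup>2 / 4)) \<le> ?p k - ?p mh"
    using a by (meson order_trans sum_mono)
  then have "(\<Sum>i\<in>?T. (x i - t i)\<^sup>2) / 2 - 3 / 2 * (\<Sum>i\<in>?T. (l i - t i)\<^sup>2) - noise_gain mh v g n u e \<le> ?p k - ?p mh"
    unfolding noise_gain_def v[symmetric] x_def[symmetric] l_def[symmetric]
    by (simp only: sum_subtractf sum_divide_distrib sum_distrib_left)
  moreover have "(\<Sum>i\<in>?T. (l i - t i)\<^sup>2) \<le> n * \<beta>"
    using sum_bounded_above[of ?T "\<lambda>i. (l i - t i)\<^sup>2" \<beta>] \<beta> by (simp add: l_def t_def)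
  moreover have "X \<le> 3 * R + 2 * P + 2 * (N - Q)" if "X / 2 - 3 / 2 * L - N \<le> P - Q" "L \<le> R"
    for X L N P Q R :: real
    using that by (simp add: field_simps)
  ultimately have "(\<Sum>i\<in>?T. (x i - t i)\<^sup>2) \<le> 3 * (n * \<beta>) + 2 * ?p k + 2 * (noise_gain mh v g n u e - ?p mh)"
    by blast
  then have "(\<Sum>i\<in>?T. (x i - t i)\<^sup>2) / n \<le> (3 * (n * \<beta>) + 2 * ?p k + 2 * (noise_gain mh v g n u e - ?p mh)) / n"
    using n0 by (intro divide_right_mono) auto
  then have "emp_sq_dist n u (Khat mh) K \<le> 3 * \<beta> + 2 * ?p k / n + 2 / n * (noise_gain mh v g n u e - ?p mh)"
    using n0 by (simp add: emp_sq_dist_def x_def t_def add_divide_distrib)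
  then show ?thesis by blast
qed

text \<open>The loss is replaced pointwise by a constant plus \<open>2 / n\<close> times
  \<open>excess\<close>, and only this measurable majorant is integrated exactly. The term
  \<open>32 * \<sigma>\<^sup>2 / n\<close> is \<open>2 / n\<close> times the expected excess
  bound.\<close>

lemma selected_risk_le:
  fixes \<nu> :: "'a::euclidean_space measure"
  assumes "1 \<le> \<kappa>" "0 < \<sigma>" "7 \<le> n"
    and gd: "gaussian_design M n \<nu> \<sigma> U \<epsilon>"
    and ls: "\<And>\<omega> m. \<omega> \<in> space M \<Longrightarrow> 1 \<le> m \<Longrightarrow>
      is_least_squares n (\<lambda>i. U i \<omega>) (\<lambda>i. support_function K (U i \<omega>) + \<epsilon> i \<omega>) (enat m) (Khat m \<omega>)"
    and sel: "\<And>\<omega>. \<omega> \<in> space M \<Longrightarrow>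
      is_arg_min (selection_criterion n (\<lambda>i. U i \<omega>) (\<lambda>i. support_function K (U i \<omega>) + \<epsilon> i \<omega>) \<kappa> \<sigma> (\<lambda>m. Khat m \<omega>))
        (\<lambda>m. 1 \<le> m) (mhat \<omega>)"
    and g: "g \<in> support_class (enat k)"
    and \<beta>: "\<And>x. norm x = 1 \<Longrightarrow> (g x - support_function K x)\<^sup>2 \<le> \<beta>" "0 \<le> \<beta>"
  shows "(\<integral>\<^sup>+\<omega>. ennreal (emp_sq_dist n (\<lambda>i. U i \<omega>) (Khat (mhat \<omega>) \<omega>) K) \<partial>M)
    \<le> ennreal (3 * \<beta> + 2 * penalty \<kappa> \<sigma> DIM('a) n k / n + 32 * \<sigma>\<^sup>2 / n)"
proof -
  let ?p = "penalty \<kappa> \<sigma> DIM('a) n"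
  let ?X = "\<lambda>\<omega>. \<lambda>i\<in>{1..n}. U i \<omega>" and ?E = "\<lambda>\<omega>. \<lambda>i\<in>{1..n}. \<epsilon> i \<omega>"
  note gd' = gd[unfolded gaussian_design_def]
  interpret prob_space M using gd' by blast
  have n0: "0 < real n" "1 \<le> n" using assms(3) by auto
  obtain w where k: "1 \<le> k" and w: "g = vertex_max k w"
    using support_class_enatE[OF g] .
  have sets_\<nu>: "sets \<nu> = sets (restrict_space borel (sphere 0 1))" using gd' by blast
  have space_\<nu>: "space \<nu> = sphere 0 1"
    using sets_eq_imp_space_eq[OF sets_\<nu>] by (simp add: space_restrict_space)
  have id\<nu>: "(\<lambda>x. x) \<in> borel_measurable \<nu>"
    unfolding measurable_cong_sets[OF sets_\<nu> refl] by (rule measurable_restrict_space1) simp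
  have U: "U i \<in> measurable M \<nu>" if "i \<in> {1..n}" for i
    using gd' that unfolding indep_vars_def by blast
  have mF: "(\<lambda>(u, e). excess \<kappa> \<sigma> n g u e) \<in> borel_measurable ((\<Pi>\<^sub>M i\<in>{1..n}. \<nu>) \<Otimes>\<^sub>M (\<Pi>\<^sub>M i\<in>{1..n}. borel))"
    by (rule measurable_excess[OF id\<nu>]) (simp add: w)
  have E: "\<epsilon> i \<in> borel_measurable M" if "i \<in> {1..n}" for i
    using gd' that unfolding indep_vars_def by blast
  have mXE: "(\<lambda>\<omega>. (?X \<omega>, ?E \<omega>)) \<in> measurable M ((\<Pi>\<^sub>M i\<in>{1..n}. \<nu>) \<Otimes>\<^sub>M (\<Pi>\<^sub>M i\<in>{1..n}. borel))"
    using U E by (intro measurable_Pair measurable_restrict) auto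
  have mFX: "(\<lambda>\<omega>. excess \<kappa> \<sigma> n g (?X \<omega>) (?E \<omega>)) \<in> borel_measurable M"
    using measurable_compose[OF mXE mF] by simp
  define a where "a = 3 * \<beta> + 2 * ?p k / n"
  have "0 \<le> ?p k"
    unfolding penalty_def using assms(1-3) k one_le_ln_3[OF k] one_le_ln_n[OF assms(3)]
    by (intro mult_nonneg_nonneg add_nonneg_nonneg) auto
  then have a0: "0 \<le> a" using \<beta>(2) by (simp add: a_def)
  have "(\<integral>\<^sup>+\<omega>. ennreal (emp_sq_dist n (\<lambda>i. U i \<omega>) (Khat (mhat \<omega>) \<omega>) K) \<partial>M)
      \<le> (\<integral>\<^sup>+\<omega>. ennreal a + ennreal (2 / n) * excess \<kappa> \<sigma> n g (?X \<omega>) (?E \<omega>) \<partial>M)"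
  proof (rule nn_integral_mono)
    fix \<omega> assume \<omega>: "\<omega> \<in> space M"
    have mh: "1 \<le> mhat \<omega>" using sel[OF \<omega>] by (simp add: is_arg_min_def)
    have unit: "norm (U i \<omega>) = 1" if "i \<in> {1..n}" for i
      using measurable_space[OF U[OF that] \<omega>] by (simp add: space_\<nu>)
    obtain v where v: "emp_sq_dist n (\<lambda>i. U i \<omega>) (Khat (mhat \<omega>) \<omega>) K \<le> 3 * \<beta> + 2 * ?p k / n
        + 2 / n * (noise_gain (mhat \<omega>) v g n (\<lambda>i. U i \<omega>) (\<lambda>i. \<epsilon> i \<omega>) - ?p (mhat \<omega>))"
      using selected_loss_le[where e = "\<lambda>i. \<epsilon> i \<omega>", OF n0(2) k mh refl ls[OF \<omega>] sel[OF \<omega>] g \<beta>(1)[OF unit]] by blast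
    have "noise_gain (mhat \<omega>) v g n (\<lambda>i. U i \<omega>) (\<lambda>i. \<epsilon> i \<omega>) = noise_gain (mhat \<omega>) v g n (?X \<omega>) (?E \<omega>)"
      unfolding noise_gain_def by (intro sum.cong) auto
    then have "ennreal (noise_gain (mhat \<omega>) v g n (\<lambda>i. U i \<omega>) (\<lambda>i. \<epsilon> i \<omega>) - ?p (mhat \<omega>)) \<le> excess \<kappa> \<sigma> n g (?X \<omega>) (?E \<omega>)"
      using noise_gain_le_excess[OF mh] by simp
    then have "ennreal (2 / n) * ennreal (noise_gain (mhat \<omega>) v g n (\<lambda>i. U i \<omega>) (\<lambda>i. \<epsilon> i \<omega>) - ?p (mhat \<omega>))
        \<le> ennreal (2 / n) * excess \<kappa> \<sigma> n g (?X \<omega>) (?E \<omega>)"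
      by (intro mult_left_mono) auto
    moreover have "ennreal (emp_sq_dist n (\<lambda>i. U i \<omega>) (Khat (mhat \<omega>) \<omega>) K)
        \<le> ennreal a + ennreal (2 / n) * ennreal (noise_gain (mhat \<omega>) v g n (\<lambda>i. U i \<omega>) (\<lambda>i. \<epsilon> i \<omega>) - ?p (mhat \<omega>))"
    proof -
      have "ennreal (emp_sq_dist n (\<lambda>i. U i \<omega>) (Khat (mhat \<omega>) \<omega>) K)
          \<le> ennreal (a + 2 / n * (noise_gain (mhat \<omega>) v g n (\<lambda>i. U i \<omega>) (\<lambda>i. \<epsilon> i \<omega>) - ?p (mhat \<omega>)))"
        using v by (intro ennreal_leI) (simp only: a_def)
      also have "\<dots> \<le> ennreal a + ennreal (2 / n * (noise_gain (mhat \<omega>) v g n (\<lambda>i. U i \<omega>) (\<lambda>i. \<epsilon> i \<omega>) - ?p (mhat \<omega>)))"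
        by (rule ennreal_add_le[OF a0])
      also have "ennreal (2 / n * (noise_gain (mhat \<omega>) v g n (\<lambda>i. U i \<omega>) (\<lambda>i. \<epsilon> i \<omega>) - ?p (mhat \<omega>)))
          = ennreal (2 / n) * ennreal (noise_gain (mhat \<omega>) v g n (\<lambda>i. U i \<omega>) (\<lambda>i. \<epsilon> i \<omega>) - ?p (mhat \<omega>))"
        by (rule ennreal_mult') simp
      finally show ?thesis .
    qed
    ultimately show "ennreal (emp_sq_dist n (\<lambda>i. U i \<omega>) (Khat (mhat \<omega>) \<omega>) K)
        \<le> ennreal a + ennreal (2 / n) * excess \<kappa> \<sigma> n g (?X \<omega>) (?E \<omega>)"
      by (meson add_left_mono order_trans)
  qed
  also have "\<dots> = ennreal a + ennreal (2 / n) * (\<integral>\<^sup>+\<omega>. excess \<kappa> \<sigma> n g (?X \<omega>) (?E \<omega>) \<partial>M)"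
    using mFX by (simp add: nn_integral_add nn_integral_cmult emeasure_space_1)
  also have "(\<integral>\<^sup>+\<omega>. excess \<kappa> \<sigma> n g (?X \<omega>) (?E \<omega>) \<partial>M) \<le> ennreal (16 * \<sigma>\<^sup>2)"
  proof -
    interpret X: prob_space "distr M (\<Pi>\<^sub>M i\<in>{1..n}. \<nu>) ?X"
      using U by (intro prob_space_distr measurable_restrict) auto
    have "(\<integral>\<^sup>+\<omega>. excess \<kappa> \<sigma> n g (?X \<omega>) (?E \<omega>) \<partial>M)
        = (\<integral>\<^sup>+u. (\<integral>\<^sup>+e. excess \<kappa> \<sigma> n g u e \<partial>(\<Pi>\<^sub>M i\<in>{1..n}. gauss \<sigma>)) \<partial>distr M (\<Pi>\<^sub>M i\<in>{1..n}. \<nu>) ?X)"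
      by (rule nn_integral_gaussian_design[OF gd n0(2) mF])
    also have "\<dots> \<le> (\<integral>\<^sup>+u. ennreal (16 * \<sigma>\<^sup>2) \<partial>distr M (\<Pi>\<^sub>M i\<in>{1..n}. \<nu>) ?X)"
      by (intro nn_integral_mono nn_integral_excess_sum_le assms)
    also have "\<dots> = ennreal (16 * \<sigma>\<^sup>2)"
      using X.emeasure_space_1 by simp
    finally show ?thesis .
  qed
  also have "ennreal a + ennreal (2 / n) * ennreal (16 * \<sigma>\<^sup>2) = ennreal (3 * \<beta> + 2 * ?p k / n + 32 * \<sigma>\<^sup>2 / n)"
    using a0 n0 by (simp add: ennreal_mult'[symmetric] ennreal_plus[symmetric] a_def del: ennreal_plus)
  finally show ?thesis by (simp add: add_left_mono mult_left_mono)
qed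

subsection \<open>Approximation by polytopes\<close>

lemma support_function_upper:
  assumes "bounded K" "x \<in> K"
  shows "x \<bullet> u \<le> support_function K u"
proof -
  obtain B where B: "\<And>x. x \<in> K \<Longrightarrow> norm x \<le> B"
    using assms(1) by (auto simp: bounded_iff)
  have "x \<bullet> u \<le> B * norm u" if "x \<in> K" for x
    using norm_cauchy_schwarz[of x u] B[OF that] by (meson mult_right_mono norm_ge_zero order_trans)
  then show ?thesis
    unfolding support_function_def using assms(2) by (intro cSUP_upper bdd_aboveI2) auto
qed

lemma support_function_least:
  assumes "K \<noteq> {}" "\<And>x. x \<in> K \<Longrightarrow> x \<bullet> u \<le> c"
  shows "support_function K u \<le> c"
  unfolding support_function_def using assms by (intro cSUP_least) auto

text \<open>Grid on the surface of the cube of half-width \<open>r\<close>: \<open>c\<close> and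
  \<open>s\<close> select a facet, the other coordinates run through multiples of
  \<open>r / N\<close>. Leaving out the interior keeps the size of order \<open>N\<close> to the
  dimension minus one.\<close>

definition cube_grid :: "real \<Rightarrow> nat \<Rightarrow> 'a::euclidean_space set" where
  "cube_grid r N = (\<lambda>k. \<Sum>b\<in>Basis. (r * real_of_int (k b) / real N) *\<^sub>R b) `
     (\<Union>(c, s)\<in>Basis \<times> {- int N, int N}. \<Pi>\<^sub>E b\<in>Basis. if b = c then {s} else {- int N..int N})"

lemma cube_grid_finite_card:
  "finite (cube_grid r N :: 'a::euclidean_space set)"
  "card (cube_grid r N :: 'a set) \<le> 2 * DIM('a) * (2 * N + 1) ^ (DIM('a) - 1)"
proof -
  define P where "P = (\<lambda>(c :: 'a, s). \<Pi>\<^sub>E b\<in>(Basis :: 'a set). if b = c then {s} else {- int N..int N})"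
  define X where "X = (Basis :: 'a set) \<times> {- int N, int N}"
  have fP: "finite (P x)" for x
    unfolding P_def by (auto split: prod.splits intro!: finite_PiE)
  have cP: "card (P x) = (2 * N + 1) ^ (DIM('a) - 1)" if x: "x \<in> X" for x
  proof -
    obtain c s where cs: "x = (c, s)" "c \<in> Basis" using x by (auto simp: X_def)
    have "card (P x) = (\<Prod>b\<in>Basis. card (if b = c then {s} else {- int N..int N}))"
      unfolding P_def cs by (simp add: card_PiE)
    also have "\<dots> = (\<Prod>b\<in>Basis - {c}. card (if b = c then {s} else {- int N..int N}))"
      using cs(2) by (subst prod.remove[of _ c]) auto
    also have "\<dots> = (\<Prod>b\<in>Basis - {c}. 2 * N + 1)"
      by (intro prod.cong) auto
    finally show ?thesis using cs(2) by (simp add: card_Diff_singleton)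
  qed
  have G: "cube_grid r N = (\<lambda>k. \<Sum>b\<in>Basis. (r * real_of_int (k b) / real N) *\<^sub>R b) ` (\<Union>x\<in>X. P x)"
    by (simp add: cube_grid_def P_def X_def)
  have fX: "finite X" by (simp add: X_def)
  show "finite (cube_grid r N :: 'a set)"
    unfolding G using fP fX by auto
  have "card (cube_grid r N :: 'a set) \<le> card (\<Union>x\<in>X. P x)"
    unfolding G using fP fX by (intro card_image_le) auto
  also have "\<dots> \<le> (\<Sum>x\<in>X. card (P x))"
    by (rule card_UN_le[OF fX])
  also have "\<dots> = card X * (2 * N + 1) ^ (DIM('a) - 1)"
    using cP by simp
  also have "card X \<le> DIM('a) * 2"
    unfolding X_def card_cartesian_product by (intro mult_left_mono) (auto simp: card_insert_if)
  finally show "card (cube_grid r N :: 'a set) \<le> 2 * DIM('a) * (2 * N + 1) ^ (DIM('a) - 1)"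
    by (simp add: mult_right_mono mult.commute)
qed

text \<open>Round each coordinate to the grid. A coordinate of modulus \<open>r\<close> is a grid
  value already, so the rounded point stays on the same facet; every other one moves by at most
  \<open>r / (2 * N)\<close>.\<close>

lemma cube_grid_close:
  fixes y :: "'a::euclidean_space"
  assumes "0 < r" "1 \<le> N" "infnorm y = r"
  shows "\<exists>g\<in>cube_grid r N. (norm (y - g))\<^sup>2 \<le> real DIM('a) * (r / (2 * N))\<^sup>2"
proof -
  have le: "\<bar>y \<bullet> b\<bar> \<le> r" if "b \<in> Basis" for b
    using Basis_le_infnorm[OF that, of y] assms(3) by simp
  have "infnorm y \<in> (\<lambda>i. \<bar>y \<bullet> i\<bar>) ` Basis"
    unfolding infnorm_Max by (intro Max_in) auto
  then obtain c where c: "c \<in> Basis" "\<bar>y \<bullet> c\<bar> = r"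
    using assms(3) by auto
  define k where "k = (\<lambda>b\<in>Basis. round (y \<bullet> b * N / r))"
  have k_eq: "k b = round (y \<bullet> b * N / r)" if "b \<in> Basis" for b
    using that by (simp add: k_def)
  have kb: "k b \<in> {- int N..int N}" if b: "b \<in> Basis" for b
  proof -
    have "- of_int (int N) \<le> y \<bullet> b * N / r" "y \<bullet> b * N / r \<le> of_int (int N)"
      using le[OF b] assms(1) mult_right_mono[of "y \<bullet> b" r "real N"] mult_right_mono[of "- r" "y \<bullet> b" "real N"]
      by (auto simp: field_simps abs_le_iff)
    then have "round (of_int (- int N) :: real) \<le> k b" "k b \<le> round (of_int (int N) :: real)"
      unfolding k_eq[OF b] by (intro round_mono; simp)+
    then show ?thesis unfolding round_of_int by simp
  qed
  define s where "s = (if 0 \<le> y \<bullet> c then int N else - int N)"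
  have "y \<bullet> c = r \<or> y \<bullet> c = - r" using c(2) by linarith
  then have "y \<bullet> c * N / r = of_int s"
    using assms(1) by (auto simp: s_def)
  then have kc: "k c = s" unfolding k_eq[OF c(1)] by (metis round_of_int)
  define g where "g = (\<Sum>b\<in>Basis. (r * real_of_int (k b) / real N) *\<^sub>R b)"
  have "k \<in> (\<Pi>\<^sub>E b\<in>Basis. if b = c then {s} else {- int N..int N})"
    using kc kb by (auto simp: k_def)
  moreover have "(c, s) \<in> Basis \<times> {- int N, int N}"
    using c(1) by (simp add: s_def)
  ultimately have gG: "g \<in> cube_grid r N"
    unfolding cube_grid_def by (intro image_eqI[where x = k] g_def UN_I[of "(c, s)"]) simp_all
  have "((y - g) \<bullet> b)\<^sup>2 \<le> (r / (2 * N))\<^sup>2" if b: "b \<in> Basis" for b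
  proof -
    have gb: "g \<bullet> b = r * real_of_int (k b) / real N"
      unfolding g_def using b by (simp add: inner_sum_left_Basis)
    have "\<bar>of_int (k b) - y \<bullet> b * N / r\<bar> \<le> 1 / 2"
      unfolding k_eq[OF b] by (rule of_int_round_abs_le)
    then have "(r / N) * \<bar>of_int (k b) - y \<bullet> b * N / r\<bar> \<le> (r / N) * (1 / 2)"
      using assms(1) by (intro mult_left_mono) auto
    also have "(r / N) * \<bar>of_int (k b) - y \<bullet> b * N / r\<bar> = \<bar>(r / N) * (of_int (k b) - y \<bullet> b * N / r)\<bar>"
      using assms(1) by (simp add: abs_mult)
    also have "(r / N) * (of_int (k b) - y \<bullet> b * N / r) = - ((y - g) \<bullet> b)"
      using assms(1,2) by (simp add: gb inner_diff_left field_simps)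
    finally have "\<bar>(y - g) \<bullet> b\<bar> \<le> r / (2 * N)" by simp
    then show ?thesis by (metis abs_ge_zero power2_abs power_mono)
  qed
  then have "(\<Sum>b\<in>Basis. ((y - g) \<bullet> b)\<^sup>2) \<le> (\<Sum>b\<in>(Basis :: 'a set). (r / (2 * N))\<^sup>2)"
    by (rule sum_mono)
  moreover have "(norm (y - g))\<^sup>2 = (\<Sum>b\<in>Basis. ((y - g) \<bullet> b)\<^sup>2)"
    unfolding power2_norm_eq_inner euclidean_inner[of "y - g" "y - g"] by (simp add: power2_eq_square)
  ultimately have "(norm (y - g))\<^sup>2 \<le> real DIM('a) * (r / (2 * N))\<^sup>2" by simp
  then show ?thesis using gG by blast
qed

text \<open>Half-width \<open>2 * R\<close> keeps the cube far enough from the ball that the ray has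
  travelled at least \<open>R\<close>. The approximation later divides by this
  \<open>t\<close>.\<close>

lemma ray_meets_cube:
  fixes x u :: "'a::euclidean_space"
  assumes "norm x \<le> R" "0 < R" "norm u = 1"
  shows "\<exists>t\<ge>R. infnorm (x + t *\<^sub>R u) = 2 * R"
proof -
  define f where "f t = infnorm (x + t *\<^sub>R u)" for t
  \<comment> \<open>At time \<open>T\<close> the Euclidean norm is at least
    \<open>2 * R * sqrt DIM('a)\<close>, which forces the sup norm up to
    \<open>2 * R\<close>.\<close>
  define T where "T = R + 2 * R * sqrt DIM('a)"
  have "f R \<le> norm (x + R *\<^sub>R u)" unfolding f_def by (rule infnorm_le_norm)
  also have "\<dots> \<le> 2 * R" using norm_triangle_ineq[of x "R *\<^sub>R u"] assms by simp
  finally have a: "f R \<le> 2 * R" .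
  have "norm (T *\<^sub>R u) \<le> norm (x + T *\<^sub>R u) + norm x"
    using norm_triangle_ineq4[of "x + T *\<^sub>R u" x] by simp
  moreover have "norm (T *\<^sub>R u) = T" using assms by (simp add: T_def)
  ultimately have "2 * R * sqrt DIM('a) \<le> norm (x + T *\<^sub>R u)"
    using assms(1) by (simp add: T_def)
  also have "\<dots> \<le> sqrt DIM('a) * f T" unfolding f_def by (rule norm_le_infnorm)
  finally have b: "2 * R \<le> f T" by (simp add: mult.commute)
  have "\<exists>t\<ge>R. t \<le> T \<and> f t = 2 * R"
    by (rule IVT'[of f, OF a b]) (use assms in \<open>auto simp: T_def f_def intro!: continuous_intros continuous_on_infnorm\<close>)
  then show ?thesis by (auto simp: f_def)
qed

text \<open>The vertices are the nearest points in \<open>K\<close> of a grid on a surrounding cube. The error is quadratic in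
  the mesh since the residuals at \<open>x\<close> and at the nearest point \<open>p\<close> of a grid point are normal to \<open>K\<close>.\<close>

lemma polytope_approximation:
  fixes K :: "'a::euclidean_space set"
  assumes K: "K \<noteq> {}" "compact K" "convex K" "K \<subseteq> cball 0 R" and R: "0 < R" and N: "1 \<le> N"
  obtains g where "g \<in> support_class (enat (2 * DIM('a) * (2 * N + 1) ^ (DIM('a) - 1)))"
    "\<And>u. norm u = 1 \<Longrightarrow> \<bar>g u - support_function K u\<bar> \<le> real DIM('a) * R / (real N)\<^sup>2"
proof -
  define S where "S = closest_point K ` cube_grid (2 * R) N"
  have clK: "closed K" using K(2) by (rule compact_imp_closed)
  have finS: "finite S" unfolding S_def by (intro finite_imageI cube_grid_finite_card)
  have cS: "card S \<le> 2 * DIM('a) * (2 * N + 1) ^ (DIM('a) - 1)"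
    unfolding S_def using card_image_le[OF cube_grid_finite_card(1)] cube_grid_finite_card(2) order_trans by blast
  have SK: "S \<subseteq> K" unfolding S_def using closest_point_in_set[OF clK K(1)] by auto
  have key: "\<exists>p\<in>S. support_function K u - p \<bullet> u \<le> real DIM('a) * R / (real N)\<^sup>2" if u: "norm u = 1" for u
  proof -
    obtain x where x: "x \<in> K" "\<And>z. z \<in> K \<Longrightarrow> z \<bullet> u \<le> x \<bullet> u"
      using continuous_attains_sup[OF K(2,1) continuous_on_inner[OF continuous_on_id continuous_on_const]]
      by metis
    have h: "support_function K u \<le> x \<bullet> u"
      using x K(1) by (intro support_function_least)
    have "norm x \<le> R" using x(1) K(4) by auto
    then obtain t where t: "R \<le> t" "infnorm (x + t *\<^sub>R u) = 2 * R"
      using ray_meets_cube[OF _ R u] by blast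
    obtain g where g: "g \<in> cube_grid (2 * R) N"
      "(norm (x + t *\<^sub>R u - g))\<^sup>2 \<le> real DIM('a) * (2 * R / (2 * N))\<^sup>2"
      using cube_grid_close[OF _ N t(2)] R by auto
    define p where "p = closest_point K g"
    define w where "w = x - p"
    define \<delta> where "\<delta> = norm (x + t *\<^sub>R u - g)"
    have "(g - p) \<bullet> w \<le> 0"
      unfolding p_def w_def by (rule closest_point_dot[OF K(3) clK x(1)])
    moreover have "(x + t *\<^sub>R u - g) \<bullet> w \<le> \<delta> * norm w"
      unfolding \<delta>_def by (rule norm_cauchy_schwarz)
    \<comment> \<open>Both sides split \<open>x + t *\<^sub>R u - p\<close> at \<open>g\<close>. The
      first summand is nonpositive because \<open>p\<close> is the nearest point to
      \<open>g\<close>, and the term \<open>(norm w)\<^sup>2\<close> absorbs the cross term, leaving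
      only \<open>\<delta>\<^sup>2\<close>.\<close>
    moreover have "t * (u \<bullet> w) = (g - p) \<bullet> w + (x + t *\<^sub>R u - g) \<bullet> w - (norm w)\<^sup>2"
      by (simp add: w_def power2_norm_eq_inner inner_diff_left inner_add_left)
    moreover have "\<delta> * norm w - (norm w)\<^sup>2 \<le> \<delta>\<^sup>2"
    proof -
      have "\<delta>\<^sup>2 - \<delta> * norm w + (norm w)\<^sup>2 = (\<delta> - norm w / 2)\<^sup>2 + 3 / 4 * (norm w)\<^sup>2"
        by (simp add: power2_eq_square algebra_simps)
      then have "0 \<le> \<delta>\<^sup>2 - \<delta> * norm w + (norm w)\<^sup>2" by simp
      then show ?thesis by linarith
    qed
    ultimately have tw: "t * (u \<bullet> w) \<le> \<delta>\<^sup>2" by linarith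
    have "p \<in> S" using g(1) by (simp add: S_def p_def)
    then have "0 \<le> u \<bullet> w"
      using x(2)[of p] SK by (auto simp: w_def inner_diff_right inner_commute)
    then have "R * (u \<bullet> w) \<le> t * (u \<bullet> w)"
      using t(1) by (intro mult_right_mono)
    also have "\<dots> \<le> real DIM('a) * (R / N)\<^sup>2"
      using tw g(2) by (simp add: \<delta>_def)
    finally have "R * (u \<bullet> w) \<le> R * (real DIM('a) * R / (real N)\<^sup>2)"
      by (simp add: power2_eq_square field_simps)
    then have "u \<bullet> w \<le> real DIM('a) * R / (real N)\<^sup>2"
      using R by (simp only: mult_le_cancel_left_pos)
    then have "x \<bullet> u - p \<bullet> u \<le> real DIM('a) * R / (real N)\<^sup>2"
      by (simp add: w_def inner_diff_right inner_commute)
    then show ?thesis using h \<open>p \<in> S\<close> by (intro bexI[of _ p]) auto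
  qed
  obtain b :: 'a where "b \<in> Basis" using nonempty_Basis by blast
  then have S0: "S \<noteq> {}" using key[of b] by auto
  let ?P = "convex hull S"
  \<comment> \<open>The polytope is inscribed, so its support function never exceeds that of
    \<open>K\<close>, and only the bound \<open>key\<close> is left for the other side.\<close>
  have PK: "?P \<subseteq> K" using SK K(3) by (rule hull_minimal)
  show ?thesis
  proof (rule that)
    show "support_function ?P \<in> support_class (enat (2 * DIM('a) * (2 * N + 1) ^ (DIM('a) - 1)))"
      by (rule support_function_convex_hull_in_class[OF finS S0 cS])
    fix u :: 'a assume u: "norm u = 1"
    have "support_function ?P u \<le> support_function K u"
      using S0 PK compact_imp_bounded[OF K(2)]
      by (intro support_function_least support_function_upper) auto
    moreover obtain p where p: "p \<in> S" "support_function K u - p \<bullet> u \<le> real DIM('a) * R / (real N)\<^sup>2"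
      using key[OF u] by blast
    moreover have "p \<bullet> u \<le> support_function ?P u"
      using p(1) bounded_subset[OF compact_imp_bounded[OF K(2)] PK]
      by (intro support_function_upper hull_inc)
    ultimately show "\<bar>support_function ?P u - support_function K u\<bar> \<le> real DIM('a) * R / (real N)\<^sup>2"
      by linarith
  qed
qed

subsection \<open>Rates\<close>

text \<open>96 is twice the factor 48 of \<open>penalty\<close>, and
  \<open>32 * \<sigma>\<^sup>2\<close> twice the bound on the expected excess; the summand 1 beside
  \<open>\<kappa>\<close> is absorbed through \<open>ln n \<ge> 1\<close>.\<close>

definition risk_const :: "real \<Rightarrow> real \<Rightarrow> nat \<Rightarrow> real" where
  "risk_const \<kappa> \<sigma> d = 96 * \<sigma>\<^sup>2 * d * (9 * 2 ^ 15 * \<kappa> + 1) + 32 * \<sigma>\<^sup>2"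

lemma penalty_rate:
  assumes "1 \<le> \<kappa>" "7 \<le> n" "1 \<le> k"
  shows "2 * penalty \<kappa> \<sigma> d n k / n + 32 * \<sigma>\<^sup>2 / n \<le> risk_const \<kappa> \<sigma> d * (real k * ln (3 * real k) * ln (real n) / real n)"
proof -
  define L where "L = ln (3 * real k)"
  define l where "l = ln (real n)"
  have L: "1 \<le> L" unfolding L_def by (rule one_le_ln_3[OF assms(3)])
  have l: "1 \<le> l" unfolding l_def by (rule one_le_ln_n[OF assms(2)])
  have kL: "1 \<le> k * L" using mult_mono[of 1 "real k" 1 L] L assms(3) by simp
  then have kLl: "1 \<le> k * L * l" using mult_mono[of 1 "k * L" 1 l] l by simp
  have "penalty \<kappa> \<sigma> d n k \<le> 48 * \<sigma>\<^sup>2 * d * (k * L) * ((9 * 2 ^ 15 * \<kappa> + 1) * l)"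
  proof -
    have "9 * 2 ^ 15 * \<kappa> * l + 1 \<le> (9 * 2 ^ 15 * \<kappa> + 1) * l"
      using l by (simp add: algebra_simps)
    then have "48 * \<sigma>\<^sup>2 * d * (k * L) * (9 * 2 ^ 15 * \<kappa> * l + 1) \<le> 48 * \<sigma>\<^sup>2 * d * (k * L) * ((9 * 2 ^ 15 * \<kappa> + 1) * l)"
      using kL L by (intro mult_left_mono mult_nonneg_nonneg) auto
    then show ?thesis by (simp add: penalty_def L_def l_def ac_simps)
  qed
  moreover have "32 * \<sigma>\<^sup>2 * 1 \<le> 32 * \<sigma>\<^sup>2 * (k * L * l)"
    using kLl by (intro mult_left_mono) auto
  ultimately have "2 * penalty \<kappa> \<sigma> d n k + 32 * \<sigma>\<^sup>2 \<le> risk_const \<kappa> \<sigma> d * (k * L * l)"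
    by (simp add: risk_const_def algebra_simps)
  then have "(2 * penalty \<kappa> \<sigma> d n k + 32 * \<sigma>\<^sup>2) / n \<le> risk_const \<kappa> \<sigma> d * (k * L * l) / n"
    by (intro divide_right_mono) auto
  then show ?thesis by (simp add: add_divide_distrib L_def l_def)
qed

text \<open>With \<open>z\<close> the fourth root of \<open>n\<close> this reduces to
  \<open>4 * (z - 1) \<le> z\<^sup>2\<close>, that is, to a square being nonnegative. It keeps the
  grid parameter chosen below at least 1.\<close>

lemma ln_square_le:
  assumes "1 \<le> n"
  shows "(ln (real n))\<^sup>2 \<le> real n"
proof -
  define z where "z = real n powr (1 / 4)"
  have z: "0 < z" using assms by (simp add: z_def)
  have z4: "z ^ 4 = n" using assms by (simp add: z_def powr_realpow[symmetric] powr_powr)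
  have "ln (real n) = 4 * ln z" using assms by (simp add: z_def ln_powr)
  also have "\<dots> \<le> 4 * (z - 1)" using ln_le_minus_one[OF z] by simp
  also have "\<dots> \<le> z\<^sup>2" using zero_le_power2[of "z - 2"] by (simp add: power2_eq_square algebra_simps)
  finally have "(ln (real n))\<^sup>2 \<le> (z\<^sup>2)\<^sup>2"
    using assms by (intro power_mono) auto
  then show ?thesis using z4 by simp
qed

text \<open>The squared approximation error, of order \<open>1 / N ^ 4\<close>, is balanced against
  \<open>N ^ (d - 1) * (ln n)\<^sup>2 / n\<close>, where the second logarithm comes from
  \<open>ln (3 * m)\<close>. Equality means \<open>N ^ (d + 3) = n / (ln n)\<^sup>2\<close>.\<close>

lemma body_rate_vertices:
  fixes n d :: nat
  assumes "7 \<le> n" "1 \<le> d"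
  obtains N where "1 \<le> N"
    "1 / real N ^ 4 \<le> real n powr (- 4 / (real d + 3)) * ln (real n) powr (8 / (real d + 3))"
    "let m = 2 * d * (2 * N + 1) ^ (d - 1) in
       real m * ln (3 * real m) * ln (real n) / real n
         \<le> 2 * d * 6 ^ (d - 1) * (ln (real d * 6 ^ d) + d) * (real n powr (- 4 / (real d + 3)) * ln (real n) powr (8 / (real d + 3)))"
proof -
  define l where "l = ln (real n)"
  define x where "x = (n / l\<^sup>2) powr (1 / (real d + 3))"
  define r where "r = n powr (- 4 / (real d + 3)) * l powr (8 / (real d + 3))"
  have n0: "0 < real n" using assms(1) by simp
  have l: "1 \<le> l" unfolding l_def by (rule one_le_ln_n[OF assms(1)])
  have "l\<^sup>2 \<le> n" unfolding l_def using assms by (intro ln_square_le) simp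
  then have nl: "1 \<le> n / l\<^sup>2" using l by (simp add: field_simps)
  then have x: "1 \<le> x" unfolding x_def by (intro ge_one_powr_ge_zero) auto
  have xd: "x ^ (d + 3) = n / l\<^sup>2"
  proof -
    have "x ^ (d + 3) = x powr real (d + 3)"
      using x by (subst powr_realpow) auto
    also have "\<dots> = (n / l\<^sup>2) powr (1 / (real d + 3) * real (d + 3))"
      by (simp only: x_def powr_powr)
    finally show ?thesis using nl by simp
  qed
  have "1 / x ^ 4 = x powr - 4" using x by (simp add: powr_minus_divide)
  also have "\<dots> = (n / l\<^sup>2) powr (- 4 / (real d + 3))"
    by (simp add: x_def powr_powr)
  also have "\<dots> = n powr (- 4 / (real d + 3)) / (l powr 2) powr (- 4 / (real d + 3))"
    using l by (simp add: powr_divide)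
  also have "\<dots> = r"
    unfolding r_def powr_powr using powr_minus_divide[of l "- (8 / (real d + 3))"] by simp
  finally have r: "r = 1 / x ^ 4" ..
  \<comment> \<open>Rounding the balancing value \<open>x\<close> up costs at most a factor 2, hence
    \<open>2 * N + 1 \<le> 6 * x\<close>.\<close>
  define N where "N = nat \<lceil>x\<rceil>"
  have N: "x \<le> N" "N \<le> 2 * x" "1 \<le> N"
    using x by (auto simp: N_def) linarith+
  define m where "m = 2 * d * (2 * N + 1) ^ (d - 1)"
  have "real m = 2 * d * (2 * real N + 1) ^ (d - 1)"
    by (simp add: m_def add.commute)
  also have "\<dots> \<le> 2 * d * (6 * x) ^ (d - 1)"
    using N x by (intro mult_left_mono power_mono) auto
  finally have m: "m \<le> 2 * d * 6 ^ (d - 1) * x ^ (d - 1)"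
    by (simp add: power_mult_distrib mult.assoc)
  have m0: "0 < m" using assms(2) by (simp add: m_def)
  \<comment> \<open>\<open>x \<le> n\<close> makes the logarithm of the number of vertices
    comparable to \<open>ln n\<close>.\<close>
  have "x \<le> x ^ (d + 3)" using x by (intro self_le_power) auto
  also have "\<dots> \<le> n" using l n0 unfolding xd by (simp add: divide_le_eq mult_le_cancel_left1 one_le_power)
  finally have lnx: "ln x \<le> l" using x by (simp add: l_def)
  have d6: "1 \<le> d * (6::real) ^ d"
    using mult_mono[of 1 "real d" 1 "(6::real) ^ d"] assms(2) by (simp add: one_le_power)
  have "3 * real m \<le> d * 6 ^ d * x ^ (d - 1)"
  proof -
    have "(6::real) ^ d = 6 * 6 ^ (d - 1)" using assms(2) by (cases d) auto
    then show ?thesis using m by (simp add: ac_simps)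
  qed
  then have "ln (3 * real m) \<le> ln (real d * 6 ^ d * x ^ (d - 1))"
    using m0 by (subst ln_le_cancel_iff) auto
  also have "\<dots> = ln (real d * 6 ^ d) + real (d - 1) * ln x"
    using x d6 assms(2) by (subst ln_mult) (auto simp: ln_realpow)
  also have "\<dots> \<le> ln (real d * 6 ^ d) * l + d * l"
  proof (rule add_mono)
    show "ln (real d * 6 ^ d) \<le> ln (real d * 6 ^ d) * l"
      using mult_left_mono[OF l, of "ln (real d * 6 ^ d)"] d6 by simp
    show "real (d - 1) * ln x \<le> d * l"
      using lnx x by (intro mult_mono) auto
  qed
  finally have L: "ln (3 * real m) \<le> (ln (real d * 6 ^ d) + d) * l" by (simp add: algebra_simps)
  have L0: "0 \<le> ln (3 * real m)" using one_le_ln_3[of m] m0 by simp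
  have "real m * ln (3 * real m) * l / real n \<le> (2 * d * 6 ^ (d - 1) * x ^ (d - 1)) * ((ln (real d * 6 ^ d) + d) * l) * l / n"
    using m L L0 l x by (intro divide_right_mono mult_right_mono mult_mono) auto
  also have "\<dots> = 2 * d * 6 ^ (d - 1) * (ln (real d * 6 ^ d) + d) * (x ^ (d - 1) * (l\<^sup>2 / n))"
    by (simp add: power2_eq_square)
  also have "x ^ (d - 1) * (l\<^sup>2 / n) = r"
  proof -
    have "l\<^sup>2 / n = 1 / x ^ (d + 3)" unfolding xd by simp
    moreover have "x ^ (d + 3) = x ^ (d - 1) * x ^ 4"
      using assms(2) by (simp add: power_add[symmetric] add.commute)
    ultimately show ?thesis using x by (simp add: r)
  qed
  finally have fin: "real m * ln (3 * real m) * l / real n \<le> 2 * d * 6 ^ (d - 1) * (ln (real d * 6 ^ d) + d) * r" .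
  have "1 / real N ^ 4 \<le> r"
    unfolding r using N x by (intro divide_left_mono power_mono mult_pos_pos) auto
  then show ?thesis
    using that[OF N(3)] fin unfolding r_def l_def Let_def m_def[symmetric] by blast
qed

theorem corollary4p16:
  fixes \<kappa> \<sigma> :: real
  assumes "2 \<le> CARD('d::finite)"
    and "covering_constant \<kappa>"
    and "0 < \<sigma>"
  shows "\<exists>C>0. \<forall>\<Gamma>. \<exists>D>0.
    \<forall>n (M :: 'w measure) (\<nu> :: (real ^ 'd) measure) U \<epsilon> K m\<^sub>K Y Khat mhat.
      7 \<le> n \<longrightarrow>
      gaussian_design M n \<nu> \<sigma> U \<epsilon> \<longrightarrow>
      K \<noteq> {} \<longrightarrow> compact K \<longrightarrow> convex K \<longrightarrow> K \<subseteq> cball 0 \<Gamma> \<longrightarrow>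
      support_function K \<in> support_class m\<^sub>K \<longrightarrow>
      Y = (\<lambda>\<omega> i. support_function K (U i \<omega>) + \<epsilon> i \<omega>) \<longrightarrow>
      (\<forall>\<omega>\<in>space M. \<forall>m\<ge>1. is_least_squares n (\<lambda>i. U i \<omega>) (Y \<omega>) (enat m) (Khat m \<omega>)) \<longrightarrow>
      (\<forall>\<omega>\<in>space M.
         is_arg_min (selection_criterion n (\<lambda>i. U i \<omega>) (Y \<omega>) \<kappa> \<sigma> (\<lambda>m. Khat m \<omega>))
           (\<lambda>m. 1 \<le> m) (mhat \<omega>)) \<longrightarrow>
      (\<integral>\<^sup>+ \<omega>. ennreal (emp_sq_dist n (\<lambda>i. U i \<omega>) (Khat (mhat \<omega>) \<omega>) K) \<partial>M)
        \<le> ennreal C * min (vertex_rate n m\<^sub>K) (ennreal D * body_rate CARD('d) n)"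
proof -
  define d where "d = CARD('d)"
  define C where "C = risk_const \<kappa> \<sigma> d"
  define B where "B = 2 * d * 6 ^ (d - 1) * (ln (real d * 6 ^ d) + d)"
  \<comment> \<open>\<open>C\<close> multiplies both terms of the minimum, so the approximation
    error is divided by it. Only this summand depends on \<open>\<Gamma>\<close>; \<open>B\<close>
    is the factor of the estimation term.\<close>
  define D where "D \<Gamma> = 3 * (d * max \<Gamma> 1)\<^sup>2 / C + B" for \<Gamma> :: real
  have \<kappa>: "1 \<le> \<kappa>" using assms(2) by (simp add: covering_constant_def)
  have d: "2 \<le> d" using assms(1) by (simp add: d_def)
  have C0: "0 < C"
    using assms(3) \<kappa> d by (auto simp: C_def risk_const_def intro!: add_nonneg_pos mult_nonneg_nonneg)
  have "1 \<le> d * (6::real) ^ d"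
    using mult_mono[of 1 "real d" 1 "(6::real) ^ d"] d by (simp add: one_le_power)
  then have B0: "0 \<le> B" by (auto simp: B_def intro!: mult_nonneg_nonneg add_nonneg_nonneg)
  have D0: "0 < D \<Gamma>" for \<Gamma>
    using C0 B0 d by (auto simp: D_def intro!: add_pos_nonneg divide_pos_pos)
  have main: "(\<integral>\<^sup>+ \<omega>. ennreal (emp_sq_dist n (\<lambda>i. U i \<omega>) (Khat (mhat \<omega>) \<omega>) K) \<partial>M)
        \<le> ennreal C * min (vertex_rate n mK) (ennreal (D \<Gamma>) * body_rate CARD('d) n)"
    if n: "7 \<le> n" and gd: "gaussian_design M n \<nu> \<sigma> U \<epsilon>"
      and K: "K \<noteq> {}" "compact K" "convex K" "K \<subseteq> cball 0 \<Gamma>" "support_function K \<in> support_class mK"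
      and ls: "\<And>\<omega> m. \<omega> \<in> space M \<Longrightarrow> 1 \<le> m \<Longrightarrow>
        is_least_squares n (\<lambda>i. U i \<omega>) (\<lambda>i. support_function K (U i \<omega>) + \<epsilon> i \<omega>) (enat m) (Khat m \<omega>)"
      and sel: "\<And>\<omega>. \<omega> \<in> space M \<Longrightarrow>
        is_arg_min (selection_criterion n (\<lambda>i. U i \<omega>) (\<lambda>i. support_function K (U i \<omega>) + \<epsilon> i \<omega>) \<kappa> \<sigma> (\<lambda>m. Khat m \<omega>))
          (\<lambda>m. 1 \<le> m) (mhat \<omega>)"
    for \<Gamma> n and M :: "'w measure" and \<nu> :: "(real ^ 'd) measure" and U \<epsilon> K mK Khat mhat
  proof -
    let ?R = "\<integral>\<^sup>+ \<omega>. ennreal (emp_sq_dist n (\<lambda>i. U i \<omega>) (Khat (mhat \<omega>) \<omega>) K) \<partial>M"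
    have dim: "DIM(real ^ 'd) = d" by (simp add: d_def)
    have risk_le: "?R \<le> ennreal (3 * \<beta> + C * (real k * ln (3 * real k) * ln (real n) / real n))"
      if g: "g \<in> support_class (enat k)" and \<beta>: "\<And>x. norm x = 1 \<Longrightarrow> (g x - support_function K x)\<^sup>2 \<le> \<beta>" "0 \<le> \<beta>"
      for g \<beta> k
    proof -
      have k: "1 \<le> k" using support_class_enatE[OF g] by blast
      have "?R \<le> ennreal (3 * \<beta> + 2 * penalty \<kappa> \<sigma> d n k / n + 32 * \<sigma>\<^sup>2 / n)"
        using selected_risk_le[OF \<kappa> assms(3) n gd ls sel g \<beta>] unfolding dim .
      also have "\<dots> \<le> ennreal (3 * \<beta> + C * (real k * ln (3 * real k) * ln (real n) / real n))"
        unfolding C_def using penalty_rate[OF \<kappa> n k, of \<sigma> d] by (intro ennreal_leI) simp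
      finally show ?thesis .
    qed
    \<comment> \<open>For finite \<open>mK\<close> the comparison function is the support function
      of \<open>K\<close> itself, with zero approximation error.\<close>
    have vertex: "?R \<le> ennreal C * vertex_rate n mK"
    proof (cases mK)
      case (enat k)
      then show ?thesis
        using risk_le[of "support_function K" k 0] K(5) C0
        by (simp add: vertex_rate_def ennreal_mult'[symmetric])
    next
      case infinity
      then show ?thesis using C0 by (simp add: vertex_rate_def ennreal_mult_top)
    qed
    define r where "r = real n powr (- 4 / (real d + 3)) * ln (real n) powr (8 / (real d + 3))"
    \<comment> \<open>The approximation requires a positive radius, whereas \<open>\<Gamma>\<close>
      may be 0.\<close>
    define R where "R = max \<Gamma> 1"
    have R: "0 < R" "K \<subseteq> cball 0 R"
      using K(4) by (auto simp: R_def)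
    have "1 \<le> d" using d by simp
    then obtain N where N: "1 \<le> N" "1 / real N ^ 4 \<le> r"
      "let m = 2 * d * (2 * N + 1) ^ (d - 1) in real m * ln (3 * real m) * ln (real n) / real n \<le> B * r"
      using body_rate_vertices[OF n, of d] unfolding B_def r_def by metis
    define m where "m = 2 * d * (2 * N + 1) ^ (d - 1)"
    obtain g where g: "g \<in> support_class (enat m)"
      "\<And>u. norm u = 1 \<Longrightarrow> \<bar>g u - support_function K u\<bar> \<le> real d * R / (real N)\<^sup>2"
      using polytope_approximation[OF K(1-3) R(2,1) N(1)] unfolding dim m_def by blast
    define \<beta> where "\<beta> = (d * R)\<^sup>2 * (1 / real N ^ 4)"
    have "(g x - support_function K x)\<^sup>2 \<le> \<beta>" if "norm x = 1" for x
    proof -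
      have "\<bar>g x - support_function K x\<bar>\<^sup>2 \<le> (real d * R / (real N)\<^sup>2)\<^sup>2"
        using g(2)[OF that] by (intro power_mono) auto
      then show ?thesis by (simp add: \<beta>_def power_divide)
    qed
    then have "?R \<le> ennreal (3 * \<beta> + C * (real m * ln (3 * real m) * ln (real n) / real n))"
      by (intro risk_le[OF g(1)]) (auto simp: \<beta>_def)
    also have "\<dots> \<le> ennreal (C * (D \<Gamma> * r))"
    proof (rule ennreal_leI)
      have "3 * \<beta> \<le> 3 * ((d * R)\<^sup>2 * r)"
        unfolding \<beta>_def using N(2) by (intro mult_left_mono) auto
      moreover have "C * (real m * ln (3 * real m) * ln (real n) / real n) \<le> C * (B * r)"
        using N(3) C0 unfolding Let_def m_def by (intro mult_left_mono) auto
      moreover have "C * (D \<Gamma> * r) = 3 * ((d * R)\<^sup>2 * r) + C * (B * r)"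
        using C0 by (simp add: D_def R_def field_simps)
      ultimately show "3 * \<beta> + C * (real m * ln (3 * real m) * ln (real n) / real n) \<le> C * (D \<Gamma> * r)" by linarith
    qed
    also have "\<dots> = ennreal C * (ennreal (D \<Gamma>) * body_rate CARD('d) n)"
    proof -
      have "body_rate CARD('d) n = ennreal r" by (simp add: body_rate_def r_def d_def)
      moreover have "0 \<le> C" "0 \<le> D \<Gamma>" using C0 D0 less_imp_le by auto
      ultimately show ?thesis by (simp add: ennreal_mult')
    qed
    finally show ?thesis using vertex by (auto simp: min_def)
  qed
  show ?thesis
    by (rule exI[of _ C], rule conjI[OF C0], rule allI, rule_tac x = "D \<Gamma>" in exI) (use D0 main in auto)
qed

end
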